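(* Fix $\varepsilon \in (0,\frac{1}{75})$. Let $n \geq 1$ be an integer, let $a=(a_1,\dots,a_n) \in \mathbb{R}^n$ with $|a|=1$ and let $t \in \mathbb{R}$ be such that $\sigma(a,t) \geq (1-\varepsilon)\sqrt{2}$. Then there exist two distinct indices $j_0, j_1 \in \{1,\dots,n\}$ such that $$ \frac{1}{\sqrt{2}}(1-37.5\,\varepsilon) \leq |a_{j_0}|,\ |a_{j_1}| \leq \frac{1}{\sqrt{2}}(1+2\varepsilon). $$ Moreover, $\sum_{j \neq j_0,j_1} a_j^2 \leq 50\,\varepsilon$ and, in particular, $|a_j| \leq \sqrt{50\,\varepsilon}$ for all $j \neq j_0,j_1$.
   Context: Here $|a| = \sqrt{a_1^2+\dots+a_n^2}$ is the Euclidean norm and $C_n = [-\frac12,\frac12]^n$ is the unit cube. For a unit vector $a \in \mathbb{R}^n$ and $t \in \mathbb{R}$, $H_{a,t} = \{x \in \mathbb{R}^n : \langle x,a\rangle = t\}$ with $\langle\cdot,\cdot\rangle$ the standard scalar product, and $\sigma(a,t) = |C_n \cap H_{a,t}|_{n-1}$ is the $(n-1)$-dimensional volume of the section of the cube by the hyperplane $H_{a,t}$. *)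

theory Defs
  imports "HOL-Analysis.Analysis"
begin

definition centered_cube :: "(real ^ 'n) set" where
  "centered_cube = {x. \<forall>i. - (1/2) \<le> x $ i \<and> x $ i \<le> 1/2}"

definition hyperplane :: "real ^ 'n \<Rightarrow> real \<Rightarrow> (real ^ 'n) set" where
  "hyperplane a t = {x. x \<bullet> a = t}"

definition orthonormal_basis_of :: "('a::euclidean_space) set \<Rightarrow> 'a set \<Rightarrow> bool" where
  "orthonormal_basis_of B V \<longleftrightarrow>
     pairwise orthogonal B \<and> (\<forall>b\<in>B. norm b = 1) \<and> span B = V"

text \<open>
  For a unit vector \<open>a\<close>, \<open>hyperplane_lborel a t\<close> is the Lebesgue-Borel measure of dimension
  \<open>CARD('n) - 1\<close> on \<open>hyperplane a t\<close>, viewed as a measure on the ambient space: the image of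
  the product Lebesgue measure under the isometric parametrization
  \<open>c \<mapsto> t a + (\<Sum>b\<in>B. c b b)\<close>, where \<open>B\<close> is an orthonormal basis of the orthogonal complement
  of \<open>a\<close>. This is how \<^const>\<open>lborel\<close> itself is built from the standard basis (lemma \<open>lborel_eq\<close>).
  The choice of \<open>B\<close> is immaterial, by \<open>hyperplane_lborel_eq\<close> below. For \<open>CARD('n) = 1\<close> the basis
  is empty and the measure is the unit point mass at \<open>t a\<close>, i.e. the measure of dimension 0.
\<close>

definition hyperplane_lborel :: "real ^ 'n \<Rightarrow> real \<Rightarrow> (real ^ 'n) measure" where
  "hyperplane_lborel a t =
     (let B = (SOME B. orthonormal_basis_of B (hyperplane a 0))
      in distr (\<Pi>\<^sub>M b\<in>B. lborel) borel (\<lambda>c. t *\<^sub>R a + (\<Sum>b\<in>B. c b *\<^sub>R b)))"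

definition cube_section_volume :: "real ^ 'n \<Rightarrow> real \<Rightarrow> real" where
  "cube_section_volume a t = measure (hyperplane_lborel a t) (centered_cube \<inter> hyperplane a t)"

lemma orthonormal_basis_of_finite:
  assumes "orthonormal_basis_of B V"
  shows "finite B"
proof -
  have "0 \<notin> B" using assms by (auto simp: orthonormal_basis_of_def)
  then have "independent B"
    using assms pairwise_orthogonal_independent by (auto simp: orthonormal_basis_of_def)
  then show ?thesis by (rule independent_imp_finite)
qed

lemma orthonormal_basis_of_inner:
  assumes "orthonormal_basis_of B V" "b \<in> B" "b' \<in> B"
  shows "b \<bullet> b' = (if b = b' then 1 else 0)"
  using assms by (auto simp: orthonormal_basis_of_def pairwise_def orthogonal_def norm_eq_1)

lemma orthonormal_basis_of_exists:
  assumes "subspace V"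
  shows "\<exists>B. orthonormal_basis_of B V"
  using orthonormal_basis_subspace[OF assms] unfolding orthonormal_basis_of_def by metis

lemma subspace_hyperplane_0: "subspace (hyperplane a 0)"
  by (auto simp: hyperplane_def subspace_def inner_add_left)

lemma orthonormal_basis_of_card:
  assumes "orthonormal_basis_of B V"
  shows "card B = dim V"
proof -
  have "0 \<notin> B" using assms by (auto simp: orthonormal_basis_of_def)
  then have "independent B"
    using assms pairwise_orthogonal_independent by (auto simp: orthonormal_basis_of_def)
  then show ?thesis using assms
    by (metis dim_span_eq_card_independent orthonormal_basis_of_def)
qed

lemma nn_integral_lborel_shift:
  fixes g :: "'a::euclidean_space \<Rightarrow> ennreal"
  assumes [measurable]: "g \<in> borel_measurable borel"
  shows "(\<integral>\<^sup>+x. g (c + x) \<partial>lborel) = (\<integral>\<^sup>+x. g x \<partial>lborel)"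
proof -
  have "(\<integral>\<^sup>+x. g x \<partial>lborel) = (\<integral>\<^sup>+x. g x \<partial>distr lborel borel ((+) c))"
    by (simp add: lborel_distr_plus)
  also have "\<dots> = (\<integral>\<^sup>+x. g (c + x) \<partial>lborel)"
    by (rule nn_integral_distr) simp_all
  finally show ?thesis ..
qed

lemma nn_integral_lborel_reflect:
  fixes g :: "'a::euclidean_space \<Rightarrow> ennreal"
  assumes [measurable]: "g \<in> borel_measurable borel"
  shows "(\<integral>\<^sup>+x. g (c - x) \<partial>lborel) = (\<integral>\<^sup>+x. g x \<partial>lborel)"
proof -
  have "lborel = distr lborel borel (\<lambda>x::'a. c - x)"
    using lborel_affine[of "-1" c] by (simp add: density_1)
  then have "(\<integral>\<^sup>+x. g x \<partial>lborel) = (\<integral>\<^sup>+x. g x \<partial>distr lborel borel (\<lambda>x::'a. c - x))"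
    by simp
  also have "\<dots> = (\<integral>\<^sup>+x. g (c - x) \<partial>lborel)"
    by (rule nn_integral_distr) simp_all
  finally show ?thesis ..
qed

text \<open>
  The library proves invariance under orthogonal transformations only for well-ordered index
  types; the argument below is the uniqueness of translation-invariant measures.
\<close>

lemma distr_lborel_orthogonal:
  fixes f :: "'a::euclidean_space \<Rightarrow> 'a"
  assumes f: "orthogonal_transformation f"
  shows "distr lborel borel f = lborel"
proof (rule measure_eqI)
  have lin: "linear f" using f by (rule orthogonal_transformation_linear)
  have surj: "surj f" using f by (rule orthogonal_transformation_surj)
  have fm[measurable]: "f \<in> borel_measurable borel"
    using lin by (intro borel_measurable_continuous_onI linear_continuous_on) (simp add: linear_linear)
  fix A assume "A \<in> sets (distr lborel borel f)"
  then have A[measurable]: "A \<in> sets borel" by simp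
  define B where "B = ball (0::'a) 1"
  have B[measurable]: "B \<in> sets borel" by (simp add: B_def)
  have fB: "indicator B (f x) = (indicator B x :: ennreal)" for x
    using f by (simp add: B_def indicator_def orthogonal_transformation_norm)
  have "emeasure lborel (f -` A) * emeasure lborel B
      = (\<integral>\<^sup>+x. indicator A (f x) * emeasure lborel B \<partial>lborel)"
  proof -
    have "(\<integral>\<^sup>+x. indicator A (f x) \<partial>lborel) = (\<integral>\<^sup>+x. indicator (f -` A) x \<partial>lborel)"
      by (simp add: indicator_def)
    also have "\<dots> = emeasure lborel (f -` A)"
      using measurable_sets_borel[OF fm A] by (intro nn_integral_indicator) simp
    finally show ?thesis by (simp add: nn_integral_multc)
  qed
  also have "\<dots> = (\<integral>\<^sup>+x. (\<integral>\<^sup>+y. indicator A (f x) * indicator B (f x + y) \<partial>lborel) \<partial>lborel)"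
  proof (rule nn_integral_cong)
    fix x
    have "(\<integral>\<^sup>+y. indicator A (f x) * indicator B (f x + y) \<partial>lborel)
        = indicator A (f x) * (\<integral>\<^sup>+y. indicator B (f x + y) \<partial>lborel)"
      by (rule nn_integral_cmult) measurable
    also have "(\<integral>\<^sup>+y. indicator B (f x + y) \<partial>lborel) = emeasure lborel B"
      using nn_integral_lborel_shift[of "indicator B" "f x"] by simp
    finally show "indicator A (f x) * emeasure lborel B
        = (\<integral>\<^sup>+y. indicator A (f x) * indicator B (f x + y) \<partial>lborel)" ..
  qed
  also have "\<dots> = (\<integral>\<^sup>+y. (\<integral>\<^sup>+x. indicator A (f x) * indicator B (f x + y) \<partial>lborel) \<partial>lborel)"
    by (rule lborel_pair.Fubini') measurable
  also have "\<dots> = (\<integral>\<^sup>+y. (\<integral>\<^sup>+x. indicator A (f x - y) * indicator B (f x) \<partial>lborel) \<partial>lborel)"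
  proof (rule nn_integral_cong)
    fix y
    obtain z where z: "f z = y" using surj by (metis surjD)
    have "f (- z + x) = f x - y" for x
      using lin z by (simp add: linear_diff)
    then show "(\<integral>\<^sup>+x. indicator A (f x) * indicator B (f x + y) \<partial>lborel)
        = (\<integral>\<^sup>+x. indicator A (f x - y) * indicator B (f x) \<partial>lborel)"
      using nn_integral_lborel_shift[of "\<lambda>x. indicator A (f x) * indicator B (f x + y)" "- z"]
      by simp
  qed
  also have "\<dots> = (\<integral>\<^sup>+x. (\<integral>\<^sup>+y. indicator A (f x - y) * indicator B (f x) \<partial>lborel) \<partial>lborel)"
    by (rule lborel_pair.Fubini') measurable
  also have "\<dots> = (\<integral>\<^sup>+x. emeasure lborel A * indicator B x \<partial>lborel)"
  proof (rule nn_integral_cong)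
    fix x
    have "(\<integral>\<^sup>+y. indicator A (f x - y) * indicator B (f x) \<partial>lborel)
        = (\<integral>\<^sup>+y. indicator A (f x - y) \<partial>lborel) * indicator B (f x)"
      by (rule nn_integral_multc) measurable
    also have "(\<integral>\<^sup>+y. indicator A (f x - y) \<partial>lborel) = emeasure lborel A"
      using nn_integral_lborel_reflect[of "indicator A" "f x"] by simp
    finally show "(\<integral>\<^sup>+y. indicator A (f x - y) * indicator B (f x) \<partial>lborel)
        = emeasure lborel A * indicator B x" by (simp add: fB)
  qed
  also have "\<dots> = emeasure lborel A * emeasure lborel B"
    by (simp add: nn_integral_cmult)
  finally have eq: "emeasure lborel (f -` A) * emeasure lborel B = emeasure lborel A * emeasure lborel B" .
  have "emeasure lborel B < \<infinity>"
    unfolding B_def by (rule emeasure_bounded_finite) simp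
  moreover have "emeasure lborel B \<noteq> 0"
    using open_not_negligible[of B] negligible_iff_null_sets[of B] B
    by (auto simp: B_def null_sets_def null_sets_completion_iff)
  ultimately have "emeasure lborel (f -` A) = emeasure lborel A"
    using eq by (auto simp: ennreal_mult_cancel_left mult.commute[of _ "emeasure lborel B"])
  then show "emeasure (distr lborel borel f) A = emeasure lborel A"
    by (simp add: emeasure_distr)
qed simp

lemma distr_PiM_lborel_reindex:
  fixes p :: "'a \<Rightarrow> 'b"
  assumes p: "bij_betw p A B" and fin: "finite A"
  shows "distr (\<Pi>\<^sub>M b\<in>B. lborel) (\<Pi>\<^sub>M b\<in>A. lborel) (\<lambda>c. \<lambda>e\<in>A. c (p e))
       = (\<Pi>\<^sub>M b\<in>A. (lborel :: real measure))"
proof -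
  interpret A: product_sigma_finite "\<lambda>_::'a. lborel :: real measure" ..
  interpret B: product_sigma_finite "\<lambda>_::'b. lborel :: real measure" ..
  have finB: "finite B" using p fin bij_betw_finite by blast
  have pB: "p e \<in> B" if "e \<in> A" for e using that p by (auto simp: bij_betw_def)
  define T :: "('b \<Rightarrow> real) \<Rightarrow> 'a \<Rightarrow> real" where "T = (\<lambda>c. \<lambda>e\<in>A. c (p e))"
  have [measurable]: "T \<in> measurable (\<Pi>\<^sub>M b\<in>B. lborel) (\<Pi>\<^sub>M b\<in>A. lborel)"
    unfolding T_def using pB by (intro measurable_restrict measurable_component_singleton) auto
  have "distr (\<Pi>\<^sub>M b\<in>B. lborel) (\<Pi>\<^sub>M b\<in>A. lborel) T = (\<Pi>\<^sub>M b\<in>A. lborel)"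
  proof (rule A.PiM_eqI)
    fix X :: "'a \<Rightarrow> real set"
    assume X: "\<And>i. i \<in> A \<Longrightarrow> X i \<in> sets lborel"
    let ?q = "inv_into A p"
    have q: "?q b \<in> A" "p (?q b) = b" if "b \<in> B" for b
      using that p by (auto simp: bij_betw_def inv_into_into f_inv_into_f)
    have qp: "?q (p e) = e" if "e \<in> A" for e
      using that p by (simp add: bij_betw_def)
    have "T -` Pi\<^sub>E A X \<inter> space (\<Pi>\<^sub>M b\<in>B. lborel) = Pi\<^sub>E B (\<lambda>b. X (?q b))"
    proof (intro set_eqI iffI)
      fix c assume c: "c \<in> T -` Pi\<^sub>E A X \<inter> space (\<Pi>\<^sub>M b\<in>B. lborel)"
      then show "c \<in> Pi\<^sub>E B (\<lambda>b. X (?q b))"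
      proof (intro PiE_I)
        fix b assume b: "b \<in> B"
        have "T c (?q b) \<in> X (?q b)" using c q(1)[OF b] by (auto simp: PiE_iff)
        then show "c b \<in> X (?q b)" using q[OF b] by (simp add: T_def)
      next
        fix b assume "b \<notin> B"
        then show "c b = undefined" using c by (auto simp: space_PiM PiE_def extensional_def)
      qed
    next
      fix c assume c: "c \<in> Pi\<^sub>E B (\<lambda>b. X (?q b))"
      have "c (p e) \<in> X e" if "e \<in> A" for e
        using c pB[OF that] qp[OF that] by (metis PiE_mem)
      then show "c \<in> T -` Pi\<^sub>E A X \<inter> space (\<Pi>\<^sub>M b\<in>B. lborel)"
        using c unfolding T_def by (auto simp: space_PiM PiE_iff)
    qed
    then have "emeasure (distr (\<Pi>\<^sub>M b\<in>B. lborel) (\<Pi>\<^sub>M b\<in>A. lborel) T) (Pi\<^sub>E A X)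
        = emeasure (\<Pi>\<^sub>M b\<in>B. lborel) (Pi\<^sub>E B (\<lambda>b. X (?q b)))"
      using X fin by (subst emeasure_distr) (auto intro!: sets_PiM_I_finite)
    also have "\<dots> = (\<Prod>b\<in>B. emeasure lborel (X (?q b)))"
      using X q finB by (intro B.emeasure_PiM) auto
    also have "\<dots> = (\<Prod>e\<in>A. emeasure lborel (X e))"
      using p qp by (subst prod.reindex_bij_betw[symmetric, OF p]) simp
    finally show "emeasure (distr (\<Pi>\<^sub>M b\<in>B. lborel) (\<Pi>\<^sub>M b\<in>A. lborel) T) (Pi\<^sub>E A X)
        = (\<Prod>e\<in>A. emeasure lborel (X e))" .
  qed (use fin in simp_all)
  then show ?thesis by (simp add: T_def)
qed

lemma orthonormal_coordinates_lborel:
  fixes B :: "(real ^ 'n) set"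
  assumes B: "orthonormal_basis_of B UNIV"
  shows "distr (\<Pi>\<^sub>M b\<in>B. lborel) borel (\<lambda>c. \<Sum>b\<in>B. c b *\<^sub>R b) = lborel"
proof -
  have finB: "finite B" using B by (rule orthonormal_basis_of_finite)
  have "card (Basis :: (real ^ 'n) set) = card B"
    using orthonormal_basis_of_card[OF B] by simp
  then obtain p where p: "bij_betw p (Basis :: (real ^ 'n) set) B"
    using finite_same_card_bij[OF finite_Basis finB] by blast
  have pB: "p e \<in> B" if "e \<in> Basis" for e using that p by (auto simp: bij_betw_def)
  have pp: "p e \<bullet> p e' = (if e = e' then 1 else 0)" if "e \<in> Basis" "e' \<in> Basis" for e e'
    using orthonormal_basis_of_inner[OF B pB[OF that(1)] pB[OF that(2)]] p that
    by (auto simp: bij_betw_def inj_on_def)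
  define f where "f = (\<lambda>x::real ^ 'n. \<Sum>e\<in>Basis. (x \<bullet> e) *\<^sub>R p e)"
  have lin: "linear f"
    unfolding f_def by (intro linearI) (simp_all add: inner_add_left scaleR_add_left sum.distrib scaleR_sum_right)
  have inn: "f x \<bullet> f y = x \<bullet> y" for x y
  proof -
    have "f x \<bullet> f y = (\<Sum>e\<in>Basis. \<Sum>e'\<in>Basis. (x \<bullet> e) * (y \<bullet> e') * (p e \<bullet> p e'))"
      unfolding f_def
      by (subst sum.swap) (simp add: inner_sum_left inner_sum_right sum_distrib_left mult_ac)
    also have "\<dots> = (\<Sum>e\<in>Basis. \<Sum>e'\<in>Basis. if e = e' then (x \<bullet> e) * (y \<bullet> e') else 0)"
      by (intro sum.cong refl) (simp add: pp)
    also have "\<dots> = x \<bullet> y" by (simp add: euclidean_inner[of x y])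
    finally show ?thesis .
  qed
  have f: "orthogonal_transformation f"
    using lin inn by (simp add: orthogonal_transformation_def)
  have [measurable]: "f \<in> borel_measurable borel"
    using lin by (intro borel_measurable_continuous_onI linear_continuous_on) (simp add: linear_linear)
  have T[measurable]: "(\<lambda>c. \<lambda>e\<in>Basis. c (p e)) \<in>
      measurable (\<Pi>\<^sub>M b\<in>B. lborel) (\<Pi>\<^sub>M b\<in>(Basis :: (real ^ 'n) set). (lborel :: real measure))"
    using pB by (intro measurable_restrict measurable_component_singleton) auto
  have S[measurable]: "(\<lambda>c. \<Sum>e\<in>Basis. c e *\<^sub>R e) \<in>
      borel_measurable (\<Pi>\<^sub>M b\<in>(Basis :: (real ^ 'n) set). (lborel :: real measure))"
    by measurable
  have fS: "f (\<Sum>e\<in>Basis. c e *\<^sub>R e) = (\<Sum>e\<in>Basis. c e *\<^sub>R p e)" for c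
    unfolding f_def by (intro sum.cong refl) simp
  have "lborel = distr lborel borel f"
    by (rule distr_lborel_orthogonal[OF f, symmetric])
  also have "\<dots> = distr (distr (\<Pi>\<^sub>M b\<in>Basis. lborel) borel (\<lambda>c. \<Sum>e\<in>Basis. c e *\<^sub>R e)) borel f"
    by (subst lborel_eq) rule
  also have "\<dots> = distr (\<Pi>\<^sub>M b\<in>Basis. lborel) borel (\<lambda>c. f (\<Sum>e\<in>Basis. c e *\<^sub>R e))"
    by (subst distr_distr) (simp_all add: o_def)
  also have "\<dots> = distr (distr (\<Pi>\<^sub>M b\<in>B. lborel) (\<Pi>\<^sub>M b\<in>Basis. lborel) (\<lambda>c. \<lambda>e\<in>Basis. c (p e))) borel
      (\<lambda>c. f (\<Sum>e\<in>Basis. c e *\<^sub>R e))"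
    by (simp add: distr_PiM_lborel_reindex[OF p])
  also have "\<dots> = distr (\<Pi>\<^sub>M b\<in>B. lborel) borel
      ((\<lambda>c. f (\<Sum>e\<in>Basis. c e *\<^sub>R e)) \<circ> (\<lambda>c. \<lambda>e\<in>Basis. c (p e)))"
    by (rule distr_distr) measurable
  also have "\<dots> = distr (\<Pi>\<^sub>M b\<in>B. lborel) borel (\<lambda>c. \<Sum>b\<in>B. c b *\<^sub>R b)"
  proof (rule distr_cong)
    fix c :: "real ^ 'n \<Rightarrow> real"
    have "(\<Sum>e\<in>Basis. c (p e) *\<^sub>R p e) = (\<Sum>b\<in>B. c b *\<^sub>R b)"
      using sum.reindex_bij_betw[OF p, of "\<lambda>b. c b *\<^sub>R b"] by simp
    then show "((\<lambda>c. f (\<Sum>e\<in>Basis. c e *\<^sub>R e)) \<circ> (\<lambda>c. \<lambda>e\<in>Basis. c (p e))) c = (\<Sum>b\<in>B. c b *\<^sub>R b)"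
      by (simp add: fS)
  qed simp_all
  finally show ?thesis ..
qed

lemma orthonormal_basis_of_insert_normal:
  fixes a :: "real ^ 'n"
  assumes B: "orthonormal_basis_of B (hyperplane a 0)" and a: "norm a = 1"
  shows "a \<notin> B" "orthonormal_basis_of (insert a B) UNIV"
proof -
  have aa: "a \<bullet> a = 1" using a by (simp add: norm_eq_1)
  have orth: "b \<bullet> a = 0" if "b \<in> B" for b
    using that B span_base[of b B] by (auto simp: orthonormal_basis_of_def hyperplane_def)
  show "a \<notin> B" using orth aa by force
  have "x \<in> span (insert a B)" for x
  proof -
    have "x - (x \<bullet> a) *\<^sub>R a \<in> span B"
      using B aa by (auto simp: orthonormal_basis_of_def hyperplane_def inner_diff_left)
    then show ?thesis by (auto simp: span_insert)
  qed
  then show "orthonormal_basis_of (insert a B) UNIV"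
    using B a orth unfolding orthonormal_basis_of_def
    by (auto simp: pairwise_insert orthogonal_def inner_commute)
qed

lemma emeasure_cylinder_over_hyperplane:
  fixes a :: "real ^ 'n"
  assumes B: "orthonormal_basis_of B (hyperplane a 0)" and a: "norm a = 1"
    and S[measurable]: "S \<in> sets borel"
  shows "emeasure (distr (\<Pi>\<^sub>M b\<in>B. lborel) borel (\<lambda>c. t *\<^sub>R a + (\<Sum>b\<in>B. c b *\<^sub>R b))) S
       = emeasure lborel {x. x \<bullet> a \<in> {0..1} \<and> x + (t - x \<bullet> a) *\<^sub>R a \<in> S}"
proof -
  interpret product_sigma_finite "\<lambda>_::real ^ 'n. lborel :: real measure" ..
  let ?P = "\<lambda>c. t *\<^sub>R a + (\<Sum>b\<in>B. c b *\<^sub>R b)"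
  let ?Q = "\<lambda>c. \<Sum>b\<in>insert a B. c b *\<^sub>R b"
  let ?C = "{x. x \<bullet> a \<in> {0..1} \<and> x + (t - x \<bullet> a) *\<^sub>R a \<in> S}"
  have fin: "finite B" using B by (rule orthonormal_basis_of_finite)
  note ins = orthonormal_basis_of_insert_normal[OF B a]
  have aa: "a \<bullet> a = 1" using a by (simp add: norm_eq_1)
  have orth: "b \<bullet> a = 0" if "b \<in> B" for b
    using that B span_base[of b B] by (auto simp: orthonormal_basis_of_def hyperplane_def)
  have C[measurable]: "?C \<in> sets borel" by measurable
  have [measurable]: "?P \<in> borel_measurable (\<Pi>\<^sub>M b\<in>B. lborel)"
    by measurable
  have [measurable]: "?Q \<in> borel_measurable (\<Pi>\<^sub>M b\<in>insert a B. lborel)"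
    by (intro borel_measurable_sum borel_measurable_scaleR) simp_all
  have key: "indicator ?C (?Q (c(a := y))) = (indicator {0..1} y * indicator S (?P c) :: ennreal)"
    for c y
  proof -
    have "(\<Sum>b\<in>B. (c(a := y)) b *\<^sub>R b) = (\<Sum>b\<in>B. c b *\<^sub>R b)"
      using ins(1) by (intro sum.cong) auto
    then have Q: "?Q (c(a := y)) = y *\<^sub>R a + (\<Sum>b\<in>B. c b *\<^sub>R b)"
      using fin ins(1) by simp
    have "(\<Sum>b\<in>B. c b *\<^sub>R b) \<bullet> a = 0" by (simp add: inner_sum_left orth)
    then have "?Q (c(a := y)) \<bullet> a = y" unfolding Q by (simp add: inner_add_left aa)
    then show ?thesis
      unfolding Q by (auto simp: indicator_def algebra_simps)
  qed
  have "emeasure lborel ?C = (\<integral>\<^sup>+x. indicator ?C x \<partial>lborel)"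
    by (rule nn_integral_indicator[symmetric]) simp
  also have "\<dots> = (\<integral>\<^sup>+x. indicator ?C x \<partial>distr (\<Pi>\<^sub>M b\<in>insert a B. lborel) borel ?Q)"
    by (simp add: orthonormal_coordinates_lborel[OF ins(2)])
  also have "\<dots> = (\<integral>\<^sup>+c. indicator ?C (?Q c) \<partial>(\<Pi>\<^sub>M b\<in>insert a B. lborel))"
    by (intro nn_integral_distr) measurable
  also have "\<dots> = (\<integral>\<^sup>+y. (\<integral>\<^sup>+c. indicator ?C (?Q (c(a := y))) \<partial>(\<Pi>\<^sub>M b\<in>B. lborel)) \<partial>lborel)"
    using fin ins(1) by (intro product_nn_integral_insert_rev) measurable
  also have "\<dots> = (\<integral>\<^sup>+y. indicator {0..1} y * (\<integral>\<^sup>+c. indicator S (?P c) \<partial>(\<Pi>\<^sub>M b\<in>B. lborel)) \<partial>(lborel :: real measure))"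
    unfolding key by (intro nn_integral_cong nn_integral_cmult) measurable
  also have "\<dots> = (\<integral>\<^sup>+c. indicator S (?P c) \<partial>(\<Pi>\<^sub>M b\<in>B. lborel))"
    by (subst nn_integral_multc) simp_all
  also have "\<dots> = (\<integral>\<^sup>+x. indicator S x \<partial>distr (\<Pi>\<^sub>M b\<in>B. lborel) borel ?P)"
    by (intro nn_integral_distr[symmetric]) measurable
  also have "\<dots> = emeasure (distr (\<Pi>\<^sub>M b\<in>B. lborel) borel ?P) S"
    by (rule nn_integral_indicator) simp
  finally show ?thesis ..
qed

lemma hyperplane_lborel_eq:
  fixes a :: "real ^ 'n"
  assumes B: "orthonormal_basis_of B (hyperplane a 0)" and a: "norm a = 1"
  shows "hyperplane_lborel a t =
           distr (\<Pi>\<^sub>M b\<in>B. lborel) borel (\<lambda>c. t *\<^sub>R a + (\<Sum>b\<in>B. c b *\<^sub>R b))"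
proof -
  define B' where "B' = (SOME B. orthonormal_basis_of B (hyperplane a 0))"
  have B': "orthonormal_basis_of B' (hyperplane a 0)"
    unfolding B'_def by (rule someI_ex) (rule orthonormal_basis_of_exists[OF subspace_hyperplane_0])
  have "hyperplane_lborel a t =
      distr (\<Pi>\<^sub>M b\<in>B'. lborel) borel (\<lambda>c. t *\<^sub>R a + (\<Sum>b\<in>B'. c b *\<^sub>R b))"
    by (simp add: hyperplane_lborel_def B'_def Let_def)
  also have "\<dots> = distr (\<Pi>\<^sub>M b\<in>B. lborel) borel (\<lambda>c. t *\<^sub>R a + (\<Sum>b\<in>B. c b *\<^sub>R b))"
    by (rule measure_eqI)
       (simp_all add: emeasure_cylinder_over_hyperplane[OF B a] emeasure_cylinder_over_hyperplane[OF B' a])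
  finally show ?thesis .
qed

end

theory Submission
  imports Defs "HOL-Probability.Probability"
begin

text \<open>
  Write \<open>x\<^sub>j = a\<^sub>j\<^sup>2\<close> and \<open>f(y) = sin(\<pi> y) / (\<pi> y)\<close>. Levy inversion bounds the section volume by
  \<open>\<integral> \<Prod>\<^sub>j \<bar>f(a\<^sub>j y)\<bar> dy\<close>, and Hoelder's inequality with exponents \<open>1 / w\<^sub>j\<close>, \<open>\<Sum>\<^sub>j w\<^sub>j = 1\<close>, by
  \<open>\<surd>2 exp (\<Sum>\<^sub>j w\<^sub>j (ln (w\<^sub>j / x\<^sub>j) / 2 - m(1 / w\<^sub>j)))\<close>, where \<open>m(p)\<close> is the gap in Ball's integral inequality
  \<open>\<integral> \<bar>f\<bar>\<^sup>p \<le> \<surd>(2 / p) exp (- m(p))\<close>. The gap vanishes only at \<open>p = 2\<close>; it is bounded below by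
  numerical estimates at \<open>p = 9/4\<close> and \<open>p \<ge> 3\<close> and by log-convexity in between. Volume at least
  \<open>(1 - \<epsilon>) \<surd>2\<close> thus bounds the total gap by about \<open>\<epsilon>\<close>. The natural weights \<open>w = x\<close> suffice
  if two of the \<open>x\<^sub>j\<close> are at most \<open>1/2\<close> and not small. If the largest one, \<open>x\<^sub>k\<close>, exceeds \<open>1/2\<close>, its weight is
  lowered to \<open>1/2\<close>. If \<open>x\<^sub>k\<close> is large and all the others are small, its weight is lowered to \<open>4/9\<close>:
  the gap at \<open>p = 9/4\<close> outweighs the relative entropy lost and excludes this case.
\<close>

subsection \<open>Slabs of the cube\<close>

text \<open>The extremal case is two weights equal to \<open>1/2\<close>, and every tool is
  borderline there. The gap is available only for exponents \<open>p \<ge> 2\<close>, so no weight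
  may exceed \<open>1/2\<close>, whereas the largest square may exceed \<open>1/2\<close> a little.
  Departing from the natural weights costs half a relative entropy. That is affordable because an
  elementary packing argument bounds the section volume by \<open>1 / \<bar>a $ k\<bar>\<close>: it
  keeps the largest square within order \<open>\<epsilon>\<close> above \<open>1/2\<close>, and the
  entropy of lowering its weight to \<open>1/2\<close> is quadratic in that excess. Near
  \<open>p = 2\<close> the gap grows at least linearly, which makes the mass outside the two largest
  squares at most linear in \<open>\<epsilon>\<close>. The weight \<open>4/9\<close> comes from the
  exponent \<open>9/4 = 2 + 1/4\<close>: the only fractional power is a fourth root, which has a
  polynomial majorant, so the moment reduces to a polynomial integral over \<open>[0, 1]\<close> and
  a tail of the exactly known integral at \<open>p = 2\<close>. This case nearly exhausts
  \<open>\<epsilon> < 1/75\<close>: gaps of about 0.0192 face a deficit of at most 1/74 plus half an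
  entropy of 0.0099, together about 0.0185.\<close>

lemma closed_centered_cube: "closed centered_cube"
proof -
  have "centered_cube = (\<Inter>i. {x::real^'n. - (1/2) \<le> x $ i} \<inter> {x. x $ i \<le> 1/2})"
    by (auto simp: centered_cube_def)
  also have "closed \<dots>"
    by (intro closed_INT ballI closed_Int closed_Collect_le continuous_intros)
  finally show ?thesis .
qed

lemma centered_cube_eq_cbox: "(centered_cube :: (real^'n) set) = cbox (\<chi> i. - (1/2)) (\<chi> i. 1/2)"
  by (auto simp: centered_cube_def mem_box_cart)

lemma emeasure_hyperplane_lborel:
  fixes a :: "real ^ 'n"
  assumes a: "norm a = 1" and S: "S \<in> sets borel"
  shows "emeasure (hyperplane_lborel a t) S
       = emeasure lborel {x. x \<bullet> a \<in> {0..1} \<and> x + (t - x \<bullet> a) *\<^sub>R a \<in> S}"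
proof -
  obtain B where B: "orthonormal_basis_of B (hyperplane a 0)"
    using orthonormal_basis_of_exists[OF subspace_hyperplane_0] by blast
  show ?thesis
    unfolding hyperplane_lborel_eq[OF B a] by (rule emeasure_cylinder_over_hyperplane[OF B a S])
qed

lemma emeasure_lborel_shift_Collect:
  fixes c :: "'a::euclidean_space"
  assumes "{x. P x} \<in> sets borel"
  shows "emeasure lborel {x. P (c + x)} = emeasure lborel {x. P x}"
proof -
  have "(+) c -` {x. P x} \<in> sets borel"
    using assms by (intro measurable_sets_borel[where M = borel]) auto
  then have m: "{x. P (c + x)} \<in> sets borel" by (simp add: vimage_def)
  have "emeasure lborel {x. P (c + x)} = (\<integral>\<^sup>+x. indicator {x. P (c + x)} x \<partial>lborel)"
    using m by (intro nn_integral_indicator[symmetric]) simp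
  also have "\<dots> = (\<integral>\<^sup>+x. indicator {x. P x} (c + x) \<partial>lborel)"
    by (simp add: indicator_def)
  also have "\<dots> = emeasure lborel {x. P x}"
    using nn_integral_lborel_shift[of "indicator {x. P x}" c] assms by simp
  finally show ?thesis .
qed

text \<open>The measure of \<open>S\<close> is the volume of the cylinder of height 1 over it. The
  cylinder is cut into \<open>m\<close> slices that are translates of one another along
  \<open>a\<close>; closed slices share faces, so only subadditivity is used.\<close>

lemma emeasure_hyperplane_le_slab:
  fixes a :: "real ^ 'n" and m :: nat
  assumes a: "norm a = 1" and S[measurable]: "S \<in> sets borel" and m: "m > 0"
  shows "emeasure (hyperplane_lborel a t) S
       \<le> of_nat m * emeasure lborel {x. x \<bullet> a \<in> {t..t + 1 / m} \<and> x + (t - x \<bullet> a) *\<^sub>R a \<in> S}"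
proof -
  let ?E = "\<lambda>s. {x. x \<bullet> a \<in> {s..s + 1 / m} \<and> x + (t - x \<bullet> a) *\<^sub>R a \<in> S}"
  have aa: "a \<bullet> a = 1" using a by (simp add: norm_eq_1)
  have E: "?E s \<in> sets borel" for s by measurable
  have shift: "emeasure lborel (?E s) = emeasure lborel (?E t)" for s
  proof -
    have key: "(t - s) *\<^sub>R a + x + (t - (t - s + x \<bullet> a)) *\<^sub>R a = x + (t - x \<bullet> a) *\<^sub>R a" for x
      by (simp add: scaleR_left_diff_distrib)
    have shift_inner: "((t - s) *\<^sub>R a + x) \<bullet> a = t - s + x \<bullet> a" for x
      by (simp add: inner_add_left aa)
    have "?E s = {x. (t - s) *\<^sub>R a + x \<in> ?E t}"
      unfolding mem_Collect_eq shift_inner key atLeastAtMost_iff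
      by (intro Collect_cong arg_cong2[where f = "(\<and>)"] refl) auto
    moreover have "emeasure lborel {x. (t - s) *\<^sub>R a + x \<in> ?E t} = emeasure lborel {x. x \<in> ?E t}"
      by (rule emeasure_lborel_shift_Collect) (simp only: Collect_mem_eq E)
    ultimately show ?thesis by (simp only: Collect_mem_eq)
  qed
  have "{x. x \<bullet> a \<in> {0..1} \<and> x + (t - x \<bullet> a) *\<^sub>R a \<in> S} \<subseteq> (\<Union>i<m. ?E (i / m))"
  proof
    fix x assume x: "x \<in> {x. x \<bullet> a \<in> {0..1} \<and> x + (t - x \<bullet> a) *\<^sub>R a \<in> S}"
    \<comment> \<open>The cap \<open>m - 1\<close> takes care of the top face
      \<open>x \<bullet> a = 1\<close>, which belongs to the last slice.\<close>
    define i where "i = min (nat \<lfloor>m * (x \<bullet> a)\<rfloor>) (m - 1)"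
    have "x \<bullet> a \<ge> i / m"
    proof -
      have "real i \<le> real_of_int \<lfloor>m * (x \<bullet> a)\<rfloor>"
        using x by (auto simp: i_def min_def)
      also have "\<dots> \<le> m * (x \<bullet> a)" by (rule of_int_floor_le)
      finally show ?thesis using m by (simp add: field_simps)
    qed
    moreover have "x \<bullet> a \<le> i / m + 1 / m"
    proof (cases "nat \<lfloor>m * (x \<bullet> a)\<rfloor> \<le> m - 1")
      case True
      then have "real i = real_of_int \<lfloor>m * (x \<bullet> a)\<rfloor>"
        using x by (simp add: i_def min_def)
      then have "m * (x \<bullet> a) \<le> real i + 1" by linarith
      then show ?thesis using m by (simp add: field_simps)
    next
      case False
      then have "real i + 1 = m" using m by (simp add: i_def min_def of_nat_diff)
      then have "i / m + 1 / m = 1" using m by (simp add: add_divide_distrib[symmetric])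
      then show ?thesis using x by simp
    qed
    moreover have "i < m" using m by (simp add: i_def)
    ultimately show "x \<in> (\<Union>i<m. ?E (i / m))" using x by auto
  qed
  then have "emeasure lborel {x. x \<bullet> a \<in> {0..1} \<and> x + (t - x \<bullet> a) *\<^sub>R a \<in> S}
      \<le> emeasure lborel (\<Union>i<m. ?E (i / m))"
    using E by (intro emeasure_mono) auto
  also have "\<dots> \<le> (\<Sum>i<m. emeasure lborel (?E (i / m)))"
    using E by (intro emeasure_subadditive_finite) auto
  also have "\<dots> = of_nat m * emeasure lborel (?E t)"
    by (subst sum.cong[OF refl shift]) simp
  finally show ?thesis by (simp add: emeasure_hyperplane_lborel[OF a S])
qed

text \<open>Since \<open>\<bar>a $ i\<bar> \<le> 1\<close>, projecting a point of the thin slice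
  along \<open>a\<close> to the hyperplane changes each coordinate by at most \<open>1/m\<close>; so
  the slice over the section lies in a slightly enlarged cube.\<close>

lemma measure_hyperplane_le_slab:
  fixes a :: "real ^ 'n" and m :: nat
  assumes a: "norm a = 1" and m: "m > 0"
  shows "cube_section_volume a t
       \<le> m * measure lborel {x. (\<forall>i. \<bar>x $ i\<bar> \<le> 1/2 + 1/m) \<and> x \<bullet> a \<in> {t..t + 1 / m}}"
proof -
  let ?D = "{x::real^'n. (\<forall>i. \<bar>x $ i\<bar> \<le> 1/2 + 1/m) \<and> x \<bullet> a \<in> {t..t + 1 / m}}"
  let ?S = "centered_cube \<inter> hyperplane a t"
  have "closed (hyperplane a t)"
    unfolding hyperplane_def by (intro closed_Collect_eq continuous_intros)
  then have S: "?S \<in> sets borel"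
    by (rule borel_closed[OF closed_Int[OF closed_centered_cube]])
  have abs_le: "\<bar>y\<bar> \<le> c \<longleftrightarrow> - c \<le> y \<and> y \<le> c" for y c :: real by linarith
  have box: "?D = cbox (\<chi> i. - (1/2 + 1/m)) (\<chi> i. 1/2 + 1/m) \<inter> {x. t \<le> x \<bullet> a} \<inter> {x. x \<bullet> a \<le> t + 1/m}"
    by (simp only: set_eq_iff Int_iff mem_Collect_eq mem_box_cart vec_lambda_beta abs_le atLeastAtMost_iff conj_assoc simp_thms)
  have clD: "closed ?D" unfolding box
    by (intro closed_Int closed_cbox closed_Collect_le continuous_intros)
  have "bounded ?D"
    unfolding box by (intro bounded_Int disjI1 bounded_cbox)
  then have fin: "emeasure lborel ?D < \<infinity>"
    by (rule emeasure_bounded_finite)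
  have "{x. x \<bullet> a \<in> {t..t + 1 / m} \<and> x + (t - x \<bullet> a) *\<^sub>R a \<in> ?S} \<subseteq> ?D"
  proof safe
    fix x i assume x: "x \<bullet> a \<in> {t..t + 1 / m}" "x + (t - x \<bullet> a) *\<^sub>R a \<in> centered_cube"
    have "\<bar>(x + (t - x \<bullet> a) *\<^sub>R a) $ i\<bar> \<le> 1/2"
      using x(2) unfolding centered_cube_def mem_Collect_eq abs_le by blast
    moreover have "\<bar>(t - x \<bullet> a) * a $ i\<bar> \<le> 1/m"
    proof -
      have "\<bar>(t - x \<bullet> a) * a $ i\<bar> \<le> (1/m) * 1"
        unfolding abs_mult using x(1) component_le_norm_cart[of a i] a
        by (intro mult_mono) auto
      then show ?thesis by simp
    qed
    ultimately show "\<bar>x $ i\<bar> \<le> 1/2 + 1/m"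
      unfolding vector_add_component vector_scaleR_component real_scaleR_def by linarith
  qed
  then have "emeasure lborel {x. x \<bullet> a \<in> {t..t + 1 / m} \<and> x + (t - x \<bullet> a) *\<^sub>R a \<in> ?S} \<le> emeasure lborel ?D"
    using clD by (intro emeasure_mono) auto
  then have "emeasure (hyperplane_lborel a t) ?S \<le> of_nat m * emeasure lborel ?D"
    using emeasure_hyperplane_le_slab[OF a S m, of t] by (meson mult_left_mono order_trans zero_le)
  also have "\<dots> = ennreal (m * measure lborel ?D)"
    using fin by (simp add: emeasure_eq_ennreal_measure ennreal_mult ennreal_of_nat_eq_real_of_nat)
  finally show ?thesis
    unfolding cube_section_volume_def measure_def by (rule enn2real_leI[rotated]) simp
qed

subsection \<open>Fourier bound for the section volume\<close>

lemma integral_lborel_prod: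
  fixes h :: "'a::euclidean_space \<Rightarrow> real \<Rightarrow> 'b::{real_normed_field, banach, second_countable_topology}"
  assumes h: "\<And>b. b \<in> Basis \<Longrightarrow> integrable lborel (h b)"
  shows "(\<integral>x. (\<Prod>b\<in>Basis. h b (x \<bullet> b)) \<partial>lborel) = (\<Prod>b\<in>Basis. \<integral>x. h b x \<partial>lborel)"
proof -
  interpret product_sigma_finite "\<lambda>_::'a. lborel :: real measure" ..
  let ?S = "\<lambda>c. \<Sum>e\<in>(Basis::'a set). c e *\<^sub>R e"
  have hm: "h b \<in> borel_measurable borel" if "b \<in> Basis" for b
    using borel_measurable_integrable[OF h[OF that]] by simp
  have F: "(\<lambda>x. \<Prod>b\<in>Basis. h b (x \<bullet> b)) \<in> borel_measurable borel"
    by (intro borel_measurable_prod measurable_compose[OF _ hm]) simp_all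
  have "?S c \<bullet> b = c b" if "b \<in> Basis" for b c
    using that by simp
  then have eq: "(\<Prod>b\<in>Basis. h b (?S c \<bullet> b)) = (\<Prod>b\<in>Basis. h b (c b))" for c
    by (intro prod.cong refl arg_cong[where f = "h _"])
  have S: "?S \<in> measurable (\<Pi>\<^sub>M b\<in>(Basis::'a set). (lborel :: real measure)) borel"
    by measurable
  have L: "(lborel :: 'a measure) = distr (\<Pi>\<^sub>M b\<in>Basis. lborel) borel ?S"
    by (rule lborel_eq)
  show "(\<integral>x. (\<Prod>b\<in>Basis. h b (x \<bullet> b)) \<partial>lborel) = (\<Prod>b\<in>Basis. \<integral>x. h b x \<partial>lborel)"
    unfolding L integral_distr[OF S F] eq
    by (rule product_integral_prod) (use h in simp_all)
qed

lemma has_bochner_integral_iexp_half_interval: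
  "has_bochner_integral lborel (\<lambda>x. indicator {- (1/2)..1/2} x *\<^sub>R iexp (s * x)) (complex_of_real (sinc (s / 2)))"
proof (cases "s = 0")
  case True
  have "has_bochner_integral lborel (indicator {- (1/2)..1/2 :: real}) (1::real)"
    using has_bochner_integral_real_indicator[of "{- (1/2)..1/2 :: real}" lborel] by simp
  from has_bochner_integral_of_real[OF this, where 'a=complex] show ?thesis
    using True by (simp add: scaleR_conv_of_real)
next
  case False
  have "((\<lambda>z. exp (\<i> * s * z) / (\<i> * s)) has_field_derivative exp (\<i> * s * of_real x)) (at (of_real x))" for x :: real
    using False by (auto intro!: derivative_eq_intros)
  then have der: "((\<lambda>x. iexp (s * x) / (\<i> * s)) has_vector_derivative iexp (s * x)) (at x within A)" for x A
    using has_vector_derivative_real_field[of "\<lambda>z. exp (\<i> * s * z) / (\<i> * s)" "exp (\<i> * s * of_real x)" x A]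
    by (simp add: mult.assoc)
  have "has_bochner_integral lborel (\<lambda>x. indicator {- (1/2)..1/2} x *\<^sub>R iexp (s * x))
      (iexp (s * (1/2)) / (\<i> * s) - iexp (s * (- (1/2))) / (\<i> * s))"
    by (intro has_bochner_integral_FTC_Icc der) (auto intro!: continuous_intros)
  also have "iexp (s * (1/2)) / (\<i> * s) - iexp (s * (- (1/2))) / (\<i> * s) = complex_of_real (sinc (s / 2))"
  proof -
    have "iexp (s * (1/2)) - iexp (s * (- (1/2))) = 2 * \<i> * sin (s / 2)"
      by (simp add: complex_eq_iff Re_exp Im_exp)
    then show ?thesis
      using False by (simp add: diff_divide_distrib[symmetric])
  qed
  finally show ?thesis .
qed

text \<open>As a probability measure it turns slab volumes into interval probabilities of the random
  variable \<open>x \<bullet> a\<close>, to which inversion of characteristic functions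
  applies.\<close>

definition cube_uniform :: "(real ^ 'n) measure" where
  "cube_uniform = density lborel (indicator centered_cube)"

lemma sets_cube_uniform [measurable_cong, simp]: "sets cube_uniform = sets borel"
  by (simp add: cube_uniform_def)

lemma space_cube_uniform [simp]: "space cube_uniform = UNIV"
  by (simp add: cube_uniform_def)

lemma borel_centered_cube [measurable]: "centered_cube \<in> sets borel"
  by (rule borel_closed[OF closed_centered_cube])

lemma emeasure_cube_uniform:
  assumes [measurable]: "A \<in> sets borel"
  shows "emeasure cube_uniform A = emeasure lborel (centered_cube \<inter> A)"
  by (simp add: cube_uniform_def emeasure_density indicator_inter_arith[symmetric])

lemma emeasure_centered_cube: "emeasure lborel (centered_cube :: (real^'n) set) = 1"
proof -
  have "emeasure lborel (centered_cube :: (real^'n) set) = ennreal (measure lborel (centered_cube :: (real^'n) set))"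
    unfolding centered_cube_eq_cbox
    using emeasure_lborel_cbox_finite by (intro emeasure_eq_ennreal_measure) (simp add: less_top)
  moreover have "measure lborel (centered_cube :: (real^'n) set) = 1"
    unfolding centered_cube_eq_cbox by (subst content_cbox_cart) (auto simp: mem_box_cart set_eq_iff intro!: exI[of _ 0])
  ultimately show ?thesis by simp
qed

lemma prob_space_cube_uniform: "prob_space cube_uniform"
  by standard (simp add: emeasure_cube_uniform emeasure_centered_cube space_cube_uniform)

lemma real_distribution_cube_uniform: "real_distribution (distr cube_uniform borel (\<lambda>x. x \<bullet> a))"
  by (intro prob_space.real_distribution_distr prob_space_cube_uniform) measurable

text \<open>Density and exponential both factor over the coordinates, so the transform is a product
  of transforms of the interval \<open>[-1/2, 1/2]\<close>.\<close>

lemma char_cube_uniform: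
  fixes a :: "real^'n"
  shows "char (distr cube_uniform borel (\<lambda>x. x \<bullet> a)) t = complex_of_real (\<Prod>i\<in>UNIV. sinc (t * a $ i / 2))"
proof -
  let ?h = "\<lambda>b x. indicator {- (1/2)..1/2} x *\<^sub>R iexp (t * (a \<bullet> b) * x)"
  have ind: "indicator centered_cube x = (\<Prod>b\<in>Basis. indicator {- (1/2)..1/2} (x \<bullet> b) :: real)" for x :: "real^'n"
  proof (cases "x \<in> centered_cube")
    case True
    then show ?thesis
      by (subst prod.neutral) (auto simp: centered_cube_def Basis_vec_def inner_axis)
  next
    case False
    then obtain i where i: "\<not> (- (1/2) \<le> x $ i \<and> x $ i \<le> 1/2)" by (auto simp: centered_cube_def)
    have "indicator {- (1/2)..1/2} (x \<bullet> axis i 1) = (0::real)" using i by (auto simp: inner_axis)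
    moreover have "axis i 1 \<in> (Basis :: (real^'n) set)" by (simp add: axis_in_Basis_iff)
    ultimately have "(\<Prod>b\<in>Basis. indicator {- (1/2)..1/2} (x \<bullet> b) :: real) = 0"
      by (intro prod_zero bexI[of _ "axis i 1"]) auto
    then show ?thesis using False by simp
  qed
  have iexp: "iexp (t * (x \<bullet> a)) = (\<Prod>b\<in>Basis. iexp (t * (a \<bullet> b) * (x \<bullet> b)))" for x :: "real^'n"
    by (subst euclidean_inner[of x a])
       (simp add: exp_sum[symmetric] sum_distrib_left mult_ac)
  have "char (distr cube_uniform borel (\<lambda>x. x \<bullet> a)) t = (\<integral>x. iexp (t * (x \<bullet> a)) \<partial>cube_uniform)"
    unfolding char_def by (subst integral_distr) auto
  also have "\<dots> = (\<integral>x. indicator centered_cube x *\<^sub>R iexp (t * (x \<bullet> a)) \<partial>lborel)"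
  proof -
    have cu: "cube_uniform = density lborel (\<lambda>x::real^'n. ennreal (indicator centered_cube x))"
      by (simp add: cube_uniform_def ennreal_indicator)
    show ?thesis unfolding cu by (subst integral_density) simp_all
  qed
  also have "\<dots> = (\<integral>x. (\<Prod>b\<in>Basis. ?h b (x \<bullet> b)) \<partial>lborel)"
    unfolding ind iexp by (simp add: prod.distrib scaleR_conv_of_real)
  also have "\<dots> = (\<Prod>b\<in>Basis. \<integral>x. ?h b x \<partial>lborel)"
    by (rule integral_lborel_prod) (rule integrable.intros[OF has_bochner_integral_iexp_half_interval])
  also have "\<dots> = (\<Prod>b\<in>Basis. complex_of_real (sinc (t * (a \<bullet> b) / 2)))"
    by (intro prod.cong refl has_bochner_integral_integral_eq has_bochner_integral_iexp_half_interval)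
  also have "\<dots> = (\<Prod>i\<in>UNIV. complex_of_real (sinc (t * a $ i / 2)))"
    by (rule prod.reindex_bij_witness[of _ "\<lambda>i. axis i 1" "\<lambda>b. (SOME i. b = axis i 1)"])
       (auto simp: Basis_vec_def inner_axis axis_eq_axis)
  finally show ?thesis by simp
qed

definition nsinc :: "real \<Rightarrow> real" where
  "nsinc x = sinc (pi * x)"

text \<open>Scaling by \<open>1 + 2/m\<close> carries the unit cube to the enlarged cube of
  \<open>measure_hyperplane_le_slab\<close>; the distortion factors tend to 1 as \<open>m\<close>
  grows. Because the slab bound is uniform in \<open>b\<close> and \<open>l\<close>, no continuity
  of the section volume in \<open>t\<close> is required.\<close>

lemma slab_bound_imp_section_bound:
  fixes a :: "real ^ 'n"
  assumes a: "norm a = 1"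
    and K: "\<And>b l. 0 \<le> l \<Longrightarrow> measure cube_uniform {x. x \<bullet> a \<in> {b..b + l}} \<le> l * K"
  shows "cube_section_volume a t \<le> K"
proof -
  let ?s = "\<lambda>m::nat. 1 + 2 * inverse (real m)"
  have le: "cube_section_volume a t \<le> ?s m ^ CARD('n) * (K / ?s m)" if m: "m > 0" for m
  proof -
    define s where "s = ?s m"
    define D where "D = {x::real^'n. (\<forall>i. \<bar>x $ i\<bar> \<le> 1/2 + 1/m) \<and> x \<bullet> a \<in> {t..t + 1 / m}}"
    define A where "A = {x::real^'n. x \<bullet> a \<in> {t / s..t / s + 1 / m / s}}"
    have s: "s > 0" by (simp add: s_def add_pos_nonneg)
    have half: "1/2 + 1/m = s * (1/2)" using m by (simp add: s_def field_simps)
    have A: "A \<in> sets borel" unfolding A_def by measurable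
    have D: "D \<in> sets borel" unfolding D_def atLeastAtMost_iff
      by (intro borel_closed closed_Collect_conj closed_Collect_all closed_Collect_le continuous_intros)
    have iff: "s *\<^sub>R x \<in> D \<longleftrightarrow> x \<in> centered_cube \<inter> A" for x
    proof -
      have "\<bar>(s *\<^sub>R x) $ i\<bar> \<le> 1/2 + 1/m \<longleftrightarrow> - (1/2) \<le> x $ i \<and> x $ i \<le> 1/2" for i
      proof -
        have "\<bar>(s *\<^sub>R x) $ i\<bar> \<le> 1/2 + 1/m \<longleftrightarrow> s * \<bar>x $ i\<bar> \<le> s * (1/2)"
          unfolding half using s by (simp add: abs_mult)
        also have "\<dots> \<longleftrightarrow> \<bar>x $ i\<bar> \<le> 1/2" using s by (simp only: mult_le_cancel_left_pos)
        finally show ?thesis by linarith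
      qed
      moreover have "(s *\<^sub>R x) \<bullet> a \<in> {t..t + 1 / m} \<longleftrightarrow> x \<in> A"
      proof -
        have "t \<le> s * (x \<bullet> a) \<longleftrightarrow> t / s \<le> x \<bullet> a"
          using s by (simp add: pos_divide_le_eq mult.commute)
        moreover have "s * (x \<bullet> a) \<le> t + 1 / m \<longleftrightarrow> x \<bullet> a \<le> t / s + 1 / m / s"
          using s unfolding add_divide_distrib[symmetric] by (simp add: pos_le_divide_eq mult.commute)
        ultimately show ?thesis by (simp add: A_def)
      qed
      ultimately show ?thesis by (simp only: centered_cube_def D_def mem_Collect_eq Int_iff)
    qed
    have "emeasure lborel D = emeasure (density (distr lborel borel (\<lambda>x. 0 + s *\<^sub>R x)) (\<lambda>_. \<bar>s\<bar>^DIM(real^'n))) D"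
      by (subst lborel_affine[of s "0 :: real^'n"]) (use s in simp_all)
    also have "\<dots> = ennreal (s ^ CARD('n)) * emeasure (distr lborel borel (\<lambda>x. 0 + s *\<^sub>R x)) D"
      using s D by (subst emeasure_density_const) simp_all
    also have "emeasure (distr lborel borel (\<lambda>x. 0 + s *\<^sub>R x)) D = emeasure lborel (centered_cube \<inter> A)"
    proof -
      have "(\<lambda>x. 0 + s *\<^sub>R x) -` D = centered_cube \<inter> A" using iff by auto
      then show ?thesis using D by (subst emeasure_distr) simp_all
    qed
    also have "\<dots> = emeasure cube_uniform A"
      by (rule emeasure_cube_uniform[OF A, symmetric])
    finally have "measure lborel D = s ^ CARD('n) * measure cube_uniform A"
      using s by (simp add: measure_def enn2real_mult)
    also have "\<dots> \<le> s ^ CARD('n) * (1 / m / s * K)"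
      unfolding A_def using s by (intro mult_left_mono K) simp_all
    finally have "m * measure lborel D \<le> m * (s ^ CARD('n) * (1 / m / s * K))"
      by (rule mult_left_mono) simp
    also have "\<dots> = s ^ CARD('n) * (K / s)"
      using m by simp
    finally show ?thesis
      using measure_hyperplane_le_slab[OF a m, of t] unfolding D_def s_def by linarith
  qed
  have "(\<lambda>m. ?s m ^ CARD('n) * (K / ?s m)) \<longlonglongrightarrow> (1 + 2 * 0) ^ CARD('n) * (K / (1 + 2 * 0))"
    by (intro tendsto_intros lim_inverse_n) auto
  then have "(\<lambda>m. ?s m ^ CARD('n) * (K / ?s m)) \<longlonglongrightarrow> K" by simp
  then show ?thesis
    by (rule tendsto_lowerbound) (use le in \<open>auto simp: eventually_sequentially intro!: exI[of _ 1]\<close>)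
qed

text \<open>
  Translates of the slab along the \<open>k\<close>-th axis pack disjointly into a box elongated in that direction.
\<close>

lemma cube_uniform_slab_le:
  fixes a :: "real ^ 'n"
  assumes k: "a $ k \<noteq> 0" and l: "0 \<le> l"
  shows "measure cube_uniform {x. x \<bullet> a \<in> {b..b + l}} \<le> l * (1 / \<bar>a $ k\<bar>)"
proof -
  let ?E = "centered_cube \<inter> {x. x \<bullet> a \<in> {b..b + l}}"
  have [measurable]: "?E \<in> sets borel" by measurable
  have Em: "measure cube_uniform {x. x \<bullet> a \<in> {b..b + l}} = measure lborel ?E"
    by (simp add: measure_def emeasure_cube_uniform)
  have "emeasure lborel ?E \<le> emeasure lborel (centered_cube :: (real^'n) set)"
    by (intro emeasure_mono) auto
  then have Efin: "emeasure lborel ?E < top"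
    by (simp add: emeasure_centered_cube order_le_less_trans)
  have bound: "measure lborel ?E \<le> inverse (real N) + (l + inverse (real N)) / \<bar>a $ k\<bar>" if N: "N > 0" for N :: nat
  proof -
    \<comment> \<open>Steps slightly longer than \<open>l\<close> keep the closed slabs disjoint;
      the excess disappears as \<open>N\<close> grows. A move by \<open>c\<close> along the axis
      \<open>k\<close> changes \<open>x \<bullet> a\<close> by \<open>l'\<close>. As
      \<open>c\<close> may be negative, the box is elongated by \<open>min\<close> and
      \<open>max\<close>.\<close>
    define l' where "l' = l + inverse (real N)"
    define c where "c = l' / a $ k"
    let ?F = "\<lambda>i::nat. {x. - (real i * c) *\<^sub>R axis k 1 + x \<in> ?E}"
    let ?lo = "\<chi> j. - (1/2) + (if j = k then min 0 (N * c) else 0)"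
    let ?hi = "\<chi> j. 1/2 + (if j = k then max 0 (N * c) else 0)"
    have Fm: "?F i \<in> sets borel" for i by measurable
    have shiftE: "emeasure lborel (?F i) = emeasure lborel ?E" for i
      using emeasure_lborel_shift_Collect[of "\<lambda>x. x \<in> ?E" "- (real i * c) *\<^sub>R axis k 1"]
      by (simp only: Collect_mem_eq) simp
    have inner: "(- (real i * c) *\<^sub>R axis k 1 + x) \<bullet> a = x \<bullet> a - real i * l'" for i x
      using k by (simp add: inner_add_left inner_diff_left inner_axis' c_def)
    have "?F i \<inter> ?F j = {}" if "i < j" for i j
    proof (rule ccontr)
      assume "?F i \<inter> ?F j \<noteq> {}"
      then obtain x where x: "x \<bullet> a - real i * l' \<le> b + l" "b \<le> x \<bullet> a - real j * l'"
        unfolding Int_iff mem_Collect_eq inner by auto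
      have "(real i + 1) * l' \<le> real j * l'"
        using that l by (intro mult_right_mono) (auto simp: l'_def)
      moreover have "l < l'" using N by (simp add: l'_def)
      ultimately show False using x by (simp add: distrib_right)
    qed
    then have disj: "disjoint_family_on ?F {..<N}"
      unfolding disjoint_family_on_def by (metis Int_commute linorder_neqE_nat)
    have "(\<Union>i<N. ?F i) \<subseteq> cbox ?lo ?hi"
    proof
      fix x assume "x \<in> (\<Union>i<N. ?F i)"
      then obtain i where i: "i < N" and x: "- (real i * c) *\<^sub>R axis k 1 + x \<in> centered_cube" by auto
      have xj: "- (1/2) \<le> x $ j - real i * c * axis k 1 $ j \<and> x $ j - real i * c * axis k 1 $ j \<le> 1/2" for j
        using x by (simp add: centered_cube_def)
      have "min 0 (N * c) \<le> real i * c \<and> real i * c \<le> max 0 (N * c)"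
      proof (cases "c \<ge> 0")
        case True
        then show ?thesis using i mult_right_mono[of "real i" "real N" c] by auto
      next
        case False
        then show ?thesis using i mult_right_mono_neg[of "real i" "real N" c]
          by (auto simp: mult_nonneg_nonpos)
      qed
      then have "?lo $ j \<le> x $ j \<and> x $ j \<le> ?hi $ j" for j
        using xj[of j] by (cases "j = k") (auto simp: axis_def)
      then show "x \<in> cbox ?lo ?hi" by (simp add: mem_box_cart)
    qed
    then have "emeasure lborel (\<Union>i<N. ?F i) \<le> emeasure lborel (cbox ?lo ?hi)"
      by (intro emeasure_mono) auto
    moreover have "emeasure lborel (\<Union>i<N. ?F i) = (\<Sum>i<N. emeasure lborel (?F i))"
      using Fm disj by (intro sum_emeasure[symmetric]) auto
    moreover have "(\<Sum>i<N. emeasure lborel (?F i)) = ennreal (real N * measure lborel ?E)"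
      using Efin by (subst sum.cong[OF refl shiftE])
        (simp add: emeasure_eq_ennreal_measure ennreal_mult ennreal_of_nat_eq_real_of_nat)
    moreover have "emeasure lborel (cbox ?lo ?hi) = ennreal (1 + N * \<bar>c\<bar>)"
    proof -
      have "measure lborel (cbox ?lo ?hi) = (\<Prod>j\<in>UNIV. ?hi $ j - ?lo $ j)"
        by (intro content_cbox_cart) (auto simp: mem_box_cart set_eq_iff intro!: exI[of _ 0])
      also have "\<dots> = (\<Prod>j\<in>UNIV. if j = k then 1 + N * \<bar>c\<bar> else 1)"
        by (intro prod.cong refl) (auto simp: min_def max_def abs_if mult_less_0_iff zero_le_mult_iff)
      finally show ?thesis
        using emeasure_lborel_cbox_finite[of ?lo ?hi] by (simp add: emeasure_eq_ennreal_measure)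
    qed
    ultimately have "ennreal (real N * measure lborel ?E) \<le> ennreal (1 + N * \<bar>c\<bar>)"
      by (simp only:)
    then have "real N * measure lborel ?E \<le> 1 + N * \<bar>c\<bar>"
      by (rule ennreal_le_iff[THEN iffD1, rotated]) simp
    then have "measure lborel ?E \<le> inverse (real N) + \<bar>c\<bar>"
      using N by (simp add: field_simps)
    moreover have "\<bar>c\<bar> = (l + inverse (real N)) / \<bar>a $ k\<bar>"
      using l by (simp add: c_def l'_def)
    ultimately show ?thesis by simp
  qed
  have "(\<lambda>N. inverse (real N) + (l + inverse (real N)) / \<bar>a $ k\<bar>) \<longlonglongrightarrow> 0 + (l + 0) / \<bar>a $ k\<bar>"
    using k by (intro tendsto_intros lim_inverse_n) auto
  then have "measure lborel ?E \<le> 0 + (l + 0) / \<bar>a $ k\<bar>"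
    by (rule tendsto_lowerbound) (use bound in \<open>auto simp: eventually_sequentially intro!: exI[of _ 1]\<close>)
  then show ?thesis unfolding Em by simp
qed

text \<open>This, and not the Fourier bound, yields the upper estimate for the largest
  component.\<close>

lemma cube_section_volume_le_inverse_component:
  fixes a :: "real ^ 'n"
  assumes "norm a = 1" "a $ k \<noteq> 0"
  shows "cube_section_volume a t \<le> 1 / \<bar>a $ k\<bar>"
  using assms by (intro slab_bound_imp_section_bound cube_uniform_slab_le)

text \<open>The kernel in Levy's inversion formula has modulus at most \<open>l\<close>. The formula
  speaks of half-open intervals, and the missing endpoint is null by \<open>atoms\<close>.\<close>

lemma (in real_distribution) measure_interval_le_integral_char:
  assumes "0 \<le> l" and atoms: "\<And>x. measure M {x} = 0"
    and int: "integrable lborel (\<lambda>t. norm (char M t))"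
  shows "measure M {b..b + l} \<le> l / (2 * pi) * (\<integral>t. norm (char M t) \<partial>lborel)"
proof -
  let ?F = "\<lambda>t. (iexp (-(t * b)) - iexp (-(t * (b + l)))) / (\<i> * t)"
  let ?I = "\<integral>t. norm (char M t) \<partial>lborel"
  have lim: "(\<lambda>T::nat. 1 / (2 * pi) * (CLBINT t=-T..T. ?F t * char M t)) \<longlonglongrightarrow> complex_of_real (measure M {b<..b + l})"
    using \<open>0 \<le> l\<close> by (intro Levy_Inversion atoms) auto
  have F: "norm (?F t) \<le> l" for t
  proof (cases "t = 0")
    case False
    have e: "- (t * b) = t * - b" "- (t * (b + l)) = t * - (b + l)" by (simp_all add: algebra_simps)
    have "norm (?F t) \<le> - b - - (b + l)"
      unfolding e using \<open>0 \<le> l\<close> False by (intro Levy_Inversion_aux2) auto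
    then show ?thesis by simp
  qed (use \<open>0 \<le> l\<close> in simp)
  have "norm (1 / (2 * pi) * (CLBINT t=-T..T. ?F t * char M t)) \<le> l / (2 * pi) * ?I" for T :: nat
  proof -
    have "norm (CLBINT t=-T..T. ?F t * char M t)
        = norm (\<integral>t. indicator {-T<..<T} t *\<^sub>R (?F t * char M t) \<partial>lborel)"
      by (simp add: interval_lebesgue_integral_def set_lebesgue_integral_def einterval_eq)
    also have "\<dots> \<le> (\<integral>t. norm (indicator {-T<..<T} t *\<^sub>R (?F t * char M t)) \<partial>lborel)"
      by (rule integral_norm_bound)
    also have "\<dots> \<le> (\<integral>t. l * norm (char M t) \<partial>lborel)"
    proof (rule integral_mono')
      fix t :: real
      have "norm (?F t) * norm (char M t) \<le> l * norm (char M t)"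
        by (intro mult_right_mono F) simp
      then show "norm (indicator {-T<..<T} t *\<^sub>R (?F t * char M t)) \<le> l * norm (char M t)"
        unfolding norm_scaleR norm_mult using \<open>0 \<le> l\<close>
        by (cases "t \<in> {-T<..<T}") (simp_all del: norm_divide)
    qed (use int \<open>0 \<le> l\<close> in auto)
    also have "\<dots> = l * ?I" by simp
    finally show ?thesis by (simp add: norm_mult norm_divide divide_right_mono)
  qed
  then have "norm (complex_of_real (measure M {b<..b + l})) \<le> l / (2 * pi) * ?I"
    by (intro Lim_norm_ubound[OF _ lim] always_eventually) auto
  moreover have "measure M {b..b + l} = measure M {b} + measure M {b<..b + l}"
  proof -
    have "{b..b + l} = {b} \<union> {b<..b + l}" using \<open>0 \<le> l\<close> by auto
    then show ?thesis by (simp only:) (rule finite_measure_Union, auto)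
  qed
  ultimately show ?thesis by (simp add: atoms)
qed

text \<open>With the nonnegative integral in the hypothesis, the integrability needed for inversion
  follows from the bound itself. Slabs of width 0 show that there are no atoms.\<close>

lemma cube_section_volume_le_nn_integral:
  fixes a :: "real ^ 'n"
  assumes a: "norm a = 1" and K: "0 \<le> K"
    and le: "(\<integral>\<^sup>+y. ennreal (\<Prod>i\<in>UNIV. \<bar>nsinc (a $ i * y)\<bar>) \<partial>lborel) \<le> ennreal K"
  shows "cube_section_volume a t \<le> K"
proof (rule slab_bound_imp_section_bound[OF a])
  fix b l :: real assume l: "0 \<le> l"
  obtain k where k: "a $ k \<noteq> 0" using a by (metis norm_zero vec_eq_iff zero_index zero_neq_one)
  let ?M = "distr cube_uniform borel (\<lambda>x. x \<bullet> a)"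
  interpret M: real_distribution ?M by (rule real_distribution_cube_uniform)
  have ch: "norm (char ?M t) = (\<Prod>i\<in>UNIV. \<bar>sinc (t * a $ i / 2)\<bar>)" for t
    by (simp add: char_cube_uniform prod_norm[symmetric] del: of_real_prod) (simp add: abs_prod)
  have ch': "norm (char ?M (2 * pi * y)) = (\<Prod>i\<in>UNIV. \<bar>nsinc (a $ i * y)\<bar>)" for y
    unfolding ch nsinc_def by (intro prod.cong refl arg_cong[where f = abs] arg_cong[where f = "\<lambda>x. sinc x"]) simp
  have slab: "measure ?M {b..b + l} = measure cube_uniform {x. x \<bullet> a \<in> {b..b + l}}" for b l
    by (subst measure_distr) (auto simp: vimage_def)
  have atom: "measure ?M {x} = 0" for x
    using slab[of x 0] cube_uniform_slab_le[of a k 0 x] k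
    by (intro antisym measure_nonneg) simp
  \<comment> \<open>The substitution \<open>t = 2 * pi * y\<close> turns \<open>sinc\<close> into
    \<open>nsinc\<close> and cancels the factor \<open>1 / (2 * pi)\<close> of the inversion
    formula.\<close>
  have "(\<integral>\<^sup>+t. ennreal (norm (char ?M t)) \<partial>lborel)
      = ennreal (2 * pi) * (\<integral>\<^sup>+y. ennreal (norm (char ?M (2 * pi * y))) \<partial>lborel)"
    using nn_integral_real_affine[of "\<lambda>t. ennreal (norm (char ?M t))" "2 * pi" 0] by simp
  also have "\<dots> \<le> ennreal (2 * pi) * ennreal K"
    using le by (intro mult_left_mono) (simp_all add: ch')
  also have "\<dots> = ennreal (2 * pi * K)" using K by (simp add: ennreal_mult)
  finally have nn: "(\<integral>\<^sup>+t. ennreal (norm (char ?M t)) \<partial>lborel) \<le> ennreal (2 * pi * K)" .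
  then have int: "integrable lborel (\<lambda>t. norm (char ?M t))"
    by (intro integrableI_bounded) (auto simp: less_top[symmetric] top_unique)
  have I: "(\<integral>t. norm (char ?M t) \<partial>lborel) \<le> 2 * pi * K"
    using nn K by (subst integral_eq_nn_integral) (auto intro!: enn2real_leI)
  have "measure ?M {b..b + l} \<le> l / (2 * pi) * (\<integral>t. norm (char ?M t) \<partial>lborel)"
    by (rule M.measure_interval_le_integral_char[OF l atom int])
  also have "\<dots> \<le> l / (2 * pi) * (2 * pi * K)"
    using I l by (intro mult_left_mono) auto
  finally show "measure cube_uniform {x. x \<bullet> a \<in> {b..b + l}} \<le> l * K"
    by (simp add: slab)
qed

subsection \<open>Hoelder's inequality with free weights\<close>

lemma weighted_arith_geometric_mean:
  fixes g w :: "'i \<Rightarrow> real"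
  assumes I: "finite I" "(\<Sum>i\<in>I. w i) = 1" "\<And>i. i \<in> I \<Longrightarrow> 0 \<le> w i" and g: "\<And>i. i \<in> I \<Longrightarrow> 0 \<le> g i"
  shows "(\<Prod>i\<in>I. g i powr w i) \<le> (\<Sum>i\<in>I. w i * g i)"
proof (cases "\<exists>i\<in>I. g i = 0")
  case True
  \<comment> \<open>\<open>0 powr w\<close> is 0 even for \<open>w = 0\<close>, so vanishing weights
    need no separate treatment.\<close>
  then have "(\<Prod>i\<in>I. g i powr w i) = 0" using I(1) by (auto intro: prod_zero)
  moreover have "0 \<le> (\<Sum>i\<in>I. w i * g i)" using I g by (intro sum_nonneg) simp
  ultimately show ?thesis by (simp only:)
next
  case False
  then have pos: "g i > 0" if "i \<in> I" for i using g[OF that] that by (metis less_eq_real_def)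
  have "I \<noteq> {}" using I(2) by auto
  then have "exp (\<Sum>i\<in>I. w i *\<^sub>R ln (g i)) \<le> (\<Sum>i\<in>I. w i * exp (ln (g i)))"
    using I by (intro convex_on_sum[of I UNIV exp w]) (auto intro!: exp_convex)
  moreover have "(\<Prod>i\<in>I. g i powr w i) = exp (\<Sum>i\<in>I. w i *\<^sub>R ln (g i))"
    using I(1) pos by (simp add: exp_sum powr_def less_imp_neq[symmetric])
  moreover have "(\<Sum>i\<in>I. w i * exp (ln (g i))) = (\<Sum>i\<in>I. w i * g i)"
    using pos by (intro sum.cong) simp_all
  ultimately show ?thesis by simp
qed

text \<open>The weighted arithmetic-geometric mean is applied pointwise to the functions
  \<open>F i x powr (1 / w i) / C i\<close>, whose integrals are at most 1. Normalizing by positive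
  upper bounds \<open>C i\<close> instead of the norms avoids the cases of zero or infinite
  norm.\<close>

lemma nn_integral_Hoelder:
  fixes F :: "'i \<Rightarrow> 'a \<Rightarrow> real" and w C :: "'i \<Rightarrow> real"
  assumes I: "finite I" "(\<Sum>i\<in>I. w i) = 1" and w: "\<And>i. i \<in> I \<Longrightarrow> 0 < w i"
    and F [measurable]: "\<And>i. i \<in> I \<Longrightarrow> F i \<in> borel_measurable M" and F0: "\<And>i x. i \<in> I \<Longrightarrow> 0 \<le> F i x"
    and C: "\<And>i. i \<in> I \<Longrightarrow> 0 < C i"
    and le: "\<And>i. i \<in> I \<Longrightarrow> (\<integral>\<^sup>+x. ennreal (F i x powr (1 / w i)) \<partial>M) \<le> ennreal (C i)"
  shows "(\<integral>\<^sup>+x. ennreal (\<Prod>i\<in>I. F i x) \<partial>M) \<le> ennreal (\<Prod>i\<in>I. C i powr w i)"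
proof -
  define K where "K = (\<Prod>i\<in>I. C i powr w i)"
  have K: "0 \<le> K" unfolding K_def by (intro prod_nonneg) simp
  have pw: "(\<Prod>i\<in>I. F i x) \<le> (\<Sum>i\<in>I. K * w i / C i * F i x powr (1 / w i))" for x
  proof -
    have "(\<Prod>i\<in>I. F i x) = (\<Prod>i\<in>I. C i powr w i * (F i x powr (1 / w i) / C i) powr w i)"
    proof (intro prod.cong refl)
      fix i assume i: "i \<in> I"
      show "F i x = C i powr w i * (F i x powr (1 / w i) / C i) powr w i"
        using C[OF i] w[OF i] F0[OF i, of x] by (simp add: powr_divide powr_powr less_imp_neq[symmetric])
    qed
    also have "\<dots> = K * (\<Prod>i\<in>I. (F i x powr (1 / w i) / C i) powr w i)"
      by (simp add: prod.distrib K_def)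
    also have "\<dots> \<le> K * (\<Sum>i\<in>I. w i * (F i x powr (1 / w i) / C i))"
      using I w C K by (intro mult_left_mono weighted_arith_geometric_mean) (auto simp: less_imp_le)
    also have "\<dots> = (\<Sum>i\<in>I. K * w i / C i * F i x powr (1 / w i))"
      by (simp add: sum_distrib_left mult_ac)
    finally show ?thesis .
  qed
  have nonneg: "0 \<le> K * w i / C i" if "i \<in> I" for i
    using w[OF that] C[OF that] K by simp
  have "(\<integral>\<^sup>+x. ennreal (\<Prod>i\<in>I. F i x) \<partial>M)
      \<le> (\<integral>\<^sup>+x. (\<Sum>i\<in>I. ennreal (K * w i / C i) * ennreal (F i x powr (1 / w i))) \<partial>M)"
  proof (rule nn_integral_mono)
    fix x
    have "(\<Sum>i\<in>I. ennreal (K * w i / C i) * ennreal (F i x powr (1 / w i)))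
        = (\<Sum>i\<in>I. ennreal (K * w i / C i * F i x powr (1 / w i)))"
      by (intro sum.cong refl ennreal_mult[symmetric] nonneg) simp_all
    also have "\<dots> = ennreal (\<Sum>i\<in>I. K * w i / C i * F i x powr (1 / w i))"
      using nonneg by (intro sum_ennreal mult_nonneg_nonneg) simp_all
    finally show "ennreal (\<Prod>i\<in>I. F i x) \<le> (\<Sum>i\<in>I. ennreal (K * w i / C i) * ennreal (F i x powr (1 / w i)))"
      using pw[of x] by (simp add: ennreal_leI)
  qed
  also have "\<dots> = (\<Sum>i\<in>I. ennreal (K * w i / C i) * (\<integral>\<^sup>+x. ennreal (F i x powr (1 / w i)) \<partial>M))"
    by (subst nn_integral_sum) (auto intro!: sum.cong nn_integral_cmult)
  also have "\<dots> \<le> (\<Sum>i\<in>I. ennreal (K * w i / C i) * ennreal (C i))"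
    using le by (intro sum_mono mult_left_mono) simp_all
  also have "\<dots> = (\<Sum>i\<in>I. ennreal (K * w i))"
  proof (intro sum.cong refl)
    fix i assume i: "i \<in> I"
    show "ennreal (K * w i / C i) * ennreal (C i) = ennreal (K * w i)"
      using C[OF i] nonneg[OF i] by (subst ennreal_mult[symmetric]) (simp_all add: less_imp_le)
  qed
  also have "\<dots> = ennreal (\<Sum>i\<in>I. K * w i)"
    using K w by (intro sum_ennreal mult_nonneg_nonneg) (auto simp: less_imp_le)
  also have "(\<Sum>i\<in>I. K * w i) = K" using I(2) by (simp add: sum_distrib_left[symmetric])
  finally show ?thesis by (simp add: K_def)
qed

definition nsinc_moment :: "real \<Rightarrow> ennreal" where
  "nsinc_moment p = (\<integral>\<^sup>+x. ennreal (\<bar>nsinc x\<bar> powr p) \<partial>lborel)"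

lemma borel_measurable_nsinc [measurable]: "nsinc \<in> borel_measurable borel"
  unfolding nsinc_def by measurable

lemma nsinc_moment_scale:
  assumes "c \<noteq> 0"
  shows "ennreal \<bar>c\<bar> * (\<integral>\<^sup>+x. ennreal (\<bar>nsinc (c * x)\<bar> powr p) \<partial>lborel) = nsinc_moment p"
  using nn_integral_real_affine[of "\<lambda>x. ennreal (\<bar>nsinc x\<bar> powr p)" c 0] assms
  by (simp add: nsinc_moment_def)

text \<open>Rescaling the variable in the \<open>j\<close>-th moment contributes
  \<open>1 / \<bar>a $ j\<bar>\<close>, and the powers of 2 combine to \<open>sqrt 2\<close> as the
  weights add up to 1. What remains in the exponent is half the relative entropy of \<open>w\<close>
  with respect to the squares of the components, minus the weighted gaps. Zero components only
  contribute factors \<open>nsinc 0 = 1\<close>.\<close>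

lemma cube_section_volume_le_weights:
  fixes a :: "real ^ 'n" and w m :: "'n \<Rightarrow> real"
  assumes a: "norm a = 1"
    and w: "\<And>j. a $ j \<noteq> 0 \<Longrightarrow> 0 < w j" "(\<Sum>j | a $ j \<noteq> 0. w j) = 1"
    and m: "\<And>j. a $ j \<noteq> 0 \<Longrightarrow> nsinc_moment (1 / w j) \<le> ennreal (sqrt (2 * w j) * exp (- m j))"
  shows "cube_section_volume a t
       \<le> sqrt 2 * exp (\<Sum>j | a $ j \<noteq> 0. w j * (ln (w j / (a $ j)\<^sup>2) / 2 - m j))"
proof -
  let ?I = "{j. a $ j \<noteq> 0}"
  define C where "C = (\<lambda>j. sqrt (2 * w j) * exp (- m j) / \<bar>a $ j\<bar>)"
  have C: "0 < C j" if "j \<in> ?I" for j using that w(1) by (simp add: C_def)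
  have "(\<integral>\<^sup>+y. ennreal (\<bar>nsinc (a $ j * y)\<bar> powr (1 / w j)) \<partial>lborel) \<le> ennreal (C j)" if j: "j \<in> ?I" for j
  proof -
    have "ennreal \<bar>a $ j\<bar> * (\<integral>\<^sup>+y. ennreal (\<bar>nsinc (a $ j * y)\<bar> powr (1 / w j)) \<partial>lborel)
        \<le> ennreal (sqrt (2 * w j) * exp (- m j))"
      using nsinc_moment_scale[of "a $ j" "1 / w j"] m j by simp
    also have "\<dots> = ennreal (\<bar>a $ j\<bar> * C j)" using j by (simp add: C_def)
    also have "\<dots> = ennreal \<bar>a $ j\<bar> * ennreal (C j)"
      using C[OF j] by (intro ennreal_mult) simp_all
    finally show ?thesis
      using j by (subst (asm) ennreal_mult_le_mult_iff) simp_all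
  qed
  then have "(\<integral>\<^sup>+y. ennreal (\<Prod>j\<in>?I. \<bar>nsinc (a $ j * y)\<bar>) \<partial>lborel) \<le> ennreal (\<Prod>j\<in>?I. C j powr w j)"
    using w C by (intro nn_integral_Hoelder) auto
  moreover have "(\<Prod>j\<in>?I. \<bar>nsinc (a $ j * y)\<bar>) = (\<Prod>j\<in>UNIV. \<bar>nsinc (a $ j * y)\<bar>)" for y
    by (rule prod.mono_neutral_left) (auto simp: nsinc_def)
  ultimately have "cube_section_volume a t \<le> (\<Prod>j\<in>?I. C j powr w j)"
    by (intro cube_section_volume_le_nn_integral[OF a]) (auto intro: prod_nonneg)
  also have "(\<Prod>j\<in>?I. C j powr w j)
      = exp (\<Sum>j\<in>?I. w j * (ln 2 / 2) + w j * (ln (w j / (a $ j)\<^sup>2) / 2 - m j))"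
  proof -
    have "C j powr w j = exp (w j * (ln 2 / 2) + w j * (ln (w j / (a $ j)\<^sup>2) / 2 - m j))" if j: "j \<in> ?I" for j
    proof -
      have "ln (C j) = ln 2 / 2 + (ln (w j / (a $ j)\<^sup>2) / 2 - m j)"
        using w(1)[of j] j ln_realpow[of "\<bar>a $ j\<bar>" 2]
        by (simp add: C_def ln_mult ln_div ln_sqrt field_simps)
      then show ?thesis using C[OF j] by (simp add: powr_def distrib_left)
    qed
    then show ?thesis by (simp add: exp_sum)
  qed
  also have "(\<Sum>j\<in>?I. w j * (ln 2 / 2) + w j * (ln (w j / (a $ j)\<^sup>2) / 2 - m j))
      = ln 2 / 2 + (\<Sum>j\<in>?I. w j * (ln (w j / (a $ j)\<^sup>2) / 2 - m j))"
    by (simp only: sum.distrib sum_distrib_right[symmetric] w(2) mult_1)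
  also have "exp (ln 2 / 2 + (\<Sum>j\<in>?I. w j * (ln (w j / (a $ j)\<^sup>2) / 2 - m j)))
      = sqrt 2 * exp (\<Sum>j\<in>?I. w j * (ln (w j / (a $ j)\<^sup>2) / 2 - m j))"
    by (simp add: exp_add ln_sqrt[symmetric])
  finally show ?thesis .
qed

subsection \<open>Pointwise bounds for the normalized sinc function\<close>

text \<open>The difference of the two sides has derivative \<open>z^3 / (1 + z)\<close>, so it is
  minimal at 0, where it vanishes.\<close>

lemma ln_one_plus_le_cubic:
  fixes y :: real
  assumes "-1 < y"
  shows "ln (1 + y) \<le> y - y^2/2 + y^3/3"
proof -
  let ?g = "\<lambda>y::real. y - y^2/2 + y^3/3 - ln (1 + y)"
  have der: "(?g has_real_derivative z^3 / (1 + z)) (at z)" if "-1 < z" for z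
    using that by (auto intro!: derivative_eq_intros simp: field_simps eval_nat_numeral)
  have "?g 0 \<le> ?g y"
  proof (cases "0 \<le> y")
    case True
    show ?thesis
    proof (rule DERIV_nonneg_imp_nondecreasing[OF True])
      fix z assume "0 \<le> z" "z \<le> y"
      then show "\<exists>d. (?g has_real_derivative d) (at z) \<and> 0 \<le> d"
        using der[of z] by (intro exI[of _ "z^3 / (1 + z)"]) auto
    qed
  next
    case False
    show ?thesis
    proof (rule DERIV_nonpos_imp_nonincreasing[of y 0])
      fix z assume "y \<le> z" "z \<le> 0"
      then show "\<exists>d. (?g has_real_derivative d) (at z) \<and> d \<le> 0"
        using der[of z] assms by (intro exI[of _ "z^3 / (1 + z)"]) (auto simp: divide_nonpos_pos)
    qed (use False in simp)
  qed
  then show ?thesis by simp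
qed

lemma sin_Taylor_11:
  fixes x :: real
  shows "\<bar>sin x - (x - x^3/6 + x^5/120 - x^7/5040 + x^9/362880)\<bar> \<le> \<bar>x\<bar>^11 / 39916800"
proof -
  have "(\<Sum>m<11. sin_coeff m * x^m) = x - x^3/6 + x^5/120 - x^7/5040 + x^9/362880"
    by (simp add: eval_nat_numeral sin_coeff_Suc cos_coeff_Suc)
  moreover have "inverse (fact 11) * \<bar>x\<bar>^11 = \<bar>x\<bar>^11 / 39916800"
    by (simp add: fact_numeral)
  ultimately show ?thesis
    using Maclaurin_sin_bound[of x 11] by (simp only:)
qed

text \<open>Each bound is decided by comparing \<open>sin\<close> at a sixth of it, evaluated by
  Taylor's formula, with \<open>sin (pi / 6) = 1/2\<close>.\<close>

lemma pi_bounds: "(314157/100000) < pi" "pi < (31416/10000)"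
proof -
  show "(314157/100000) < pi"
  proof (rule ccontr)
    assume "\<not> (314157/100000) < pi"
    then have "sin (pi / 6) \<le> sin ((314157/100000) / 6)"
      using pi_ge_two by (intro sin_monotone_2pi_le) auto
    moreover have "sin ((314157/100000) / 6) < (1 / 2 :: real)"
      using sin_Taylor_11[of "(314157/100000) / 6"] unfolding abs_le_iff by (simp add: power_divide)
    ultimately show False by (simp add: sin_30)
  qed
  show "pi < (31416/10000)"
  proof (rule ccontr)
    assume "\<not> pi < (31416/10000)"
    then have "sin ((31416/10000) / 6) \<le> sin (pi / 6)"
      by (intro sin_monotone_2pi_le) auto
    moreover have "sin ((31416/10000) / 6) > (1 / 2 :: real)"
      using sin_Taylor_11[of "(31416/10000) / 6"] unfolding abs_le_iff by (simp add: power_divide)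
    ultimately show False by (simp add: sin_30)
  qed
qed

lemma nsinc_minus [simp]: "nsinc (- x) = nsinc x"
  by (simp add: nsinc_def)

text \<open>
  The Taylor polynomial of \<open>nsinc\<close> in \<open>t = x\<^sup>2\<close>, with coefficients rounded upwards and the
  remainder absorbed into the last one.
\<close>

definition nsinc_majorant :: "real \<Rightarrow> real" where
  "nsinc_majorant t = 1 - (16449/10000) * t + (8118/10000) * t^2 - (1907/10000) * t^3 + (286/10000) * t^4"

lemma pi_square_bounds: "986946/100000 < pi^2" "pi^2 < 986966/100000"
proof -
  have "(314157/100000)^2 < pi^2" using pi_bounds by (intro power_strict_mono) auto
  moreover have "986946/100000 < (314157/100000 :: real)^2" by (simp add: power_divide)
  ultimately show "986946/100000 < pi^2" by (rule less_trans[rotated])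
  have "pi^2 < (31416/10000)^2" using pi_bounds by (intro power_strict_mono) auto
  moreover have "(31416/10000 :: real)^2 < 986966/100000" by (simp add: power_divide)
  ultimately show "pi^2 < 986966/100000" by (rule less_trans)
qed

lemma nsinc_Taylor:
  assumes "z = pi^2 * x^2"
  shows "\<bar>nsinc x - (1 - z/6 + z^2/120 - z^3/5040 + z^4/362880)\<bar> \<le> z^5 / 39916800"
proof (cases "x = 0")
  case True
  then show ?thesis using assms by (simp add: nsinc_def)
next
  case False
  define u where "u = pi * x"
  have u: "u \<noteq> 0" using False by (simp add: u_def)
  have z: "z = u^2" by (simp add: assms u_def power_mult_distrib)
  have us: "u * nsinc x = sin u"
    using False by (simp add: nsinc_def u_def)
  have "u * (nsinc x - (1 - z/6 + z^2/120 - z^3/5040 + z^4/362880))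
      = sin u - (u - u^3/6 + u^5/120 - u^7/5040 + u^9/362880)"
    unfolding z us[symmetric] by algebra
  then have "\<bar>u\<bar> * \<bar>nsinc x - (1 - z/6 + z^2/120 - z^3/5040 + z^4/362880)\<bar> \<le> \<bar>u\<bar>^11 / 39916800"
    using sin_Taylor_11[of u] by (simp add: abs_mult[symmetric])
  also have "\<bar>u\<bar>^11 = \<bar>u\<bar> * (\<bar>u\<bar>^2)^5" by algebra
  also have "\<bar>u\<bar> * (\<bar>u\<bar>^2)^5 / 39916800 = \<bar>u\<bar> * (z^5 / 39916800)" by (simp add: z)
  finally show ?thesis using u by simp
qed

text \<open>In the lower estimate, \<open>3/10000 * x^2\<close> collects the roundings of the
  coefficients below the quartic one, using \<open>x^2 \<le> 1\<close>. The term in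
  \<open>x^8\<close> covers the rounding of the quartic coefficient and twice the Taylor remainder,
  once for the part absorbed into the majorant and once for the remainder itself.\<close>

lemma nsinc_bounds:
  assumes "\<bar>x\<bar> \<le> 1"
  shows "nsinc x \<le> nsinc_majorant (x^2)" "nsinc_majorant (x^2) - (3/10000) * x^2 - (52/10000) * x^8 \<le> nsinc x"
proof -
  define t where "t = x^2"
  define P where "P = pi^2"
  have t: "0 \<le> t" "t \<le> 1" using assms by (auto simp: t_def abs_square_le_1)
  have P: "(986946/100000) < P" "P < (986966/100000)" using pi_square_bounds by (auto simp: P_def)
  have P2: "(97406/1000) < P^2" "P^2 < (97411/1000)"
    using mult_strict_mono[OF P(1) P(1)] mult_strict_mono[OF P(2) P(2)] P by (auto simp: power2_eq_square)
  have P3: "(96133/100) < P^3" "P^3 < (96142/100)"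
    using mult_strict_mono[OF P2(1) P(1)] mult_strict_mono[OF P2(2) P(2)] P P2 by (auto simp: power3_eq_cube power2_eq_square)
  have P4: "(94879/10) < P^4" "P^4 < 9489"
    using mult_strict_mono[OF P2(1) P2(1)] mult_strict_mono[OF P2(2) P2(2)] P P2 by (auto simp: power4_eq_xxxx power2_eq_square mult.assoc)
  have P5: "P^5 < 93654" "0 \<le> P^5"
    using mult_strict_mono[OF P4(2) P(2)] P P4 by (auto simp: eval_nat_numeral mult_ac)
  let ?T = "1 - (P*t)/6 + (P*t)^2/120 - (P*t)^3/5040 + (P*t)^4/362880"
  have T: "\<bar>nsinc x - ?T\<bar> \<le> (P*t)^5 / 39916800"
    by (rule nsinc_Taylor) (simp add: P_def t_def)
  have t4: "t^5 \<le> t^4" "0 \<le> t^4" using t by (auto intro: power_decreasing)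
  have tt: "t^2 \<le> t" "t^3 \<le> t" using t power_decreasing[of 1 2 t] power_decreasing[of 1 3 t] by auto
  have c: "(16449/10000) * t \<le> P/6 * t" "P/6 * t \<le> (164495/100000) * t"
     "P^2/120 * t^2 \<le> (8118/10000) * t^2" "(8117/10000) * t^2 \<le> P^2/120 * t^2"
     "(1907/10000) * t^3 \<le> P^3/5040 * t^3" "P^3/5040 * t^3 \<le> (19077/100000) * t^3"
     "P^4/362880 * t^4 \<le> (2615/100000) * t^4" "(2614/100000) * t^4 \<le> P^4/362880 * t^4"
     "P^5/39916800 * t^5 \<le> (235/100000) * t^5"
    by (rule mult_right_mono, use P P2 P3 P4 P5 in simp, use t in simp)+
  have eq: "?T = 1 - P/6*t + P^2/120 * t^2 - P^3/5040 * t^3 + P^4/362880 * t^4"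
    "(P*t)^5 / 39916800 = P^5/39916800 * t^5"
    by (simp_all add: power_mult_distrib)
  show "nsinc x \<le> nsinc_majorant (x^2)"
    using T c t4 unfolding eq nsinc_majorant_def t_def[symmetric] by linarith
  have "x^8 = t^4" by (simp add: t_def power_mult[symmetric])
  then show "nsinc_majorant (x^2) - (3/10000) * x^2 - (52/10000) * x^8 \<le> nsinc x"
    using T c t4 t tt unfolding eq nsinc_majorant_def t_def[symmetric] by linarith
qed


text \<open>Makes \<open>nsinc x powr (1/4)\<close> at most linear in \<open>x^2\<close>. The number
  \<open>411/1000\<close> is \<open>pi^2 / 24\<close>, the first Taylor coefficient of the fourth
  root up to sign, rounded down.\<close>

lemma nsinc_majorant_le_fourth_power:
  assumes "0 \<le> t" "t \<le> 1"
  shows "nsinc_majorant t \<le> (1 - (411/1000) * t)^4"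
proof -
  have t: "t^3 \<le> t^2" "t^4 \<ge> 0" "t^2 \<ge> 0" using assms by (auto intro: power_decreasing)
  have e: "(1 - (411/1000) * t)^4 = 1 - (1644/1000) * t + (1013526/1000000) * t^2 - (277706124/1000000000)*t^3 + (28534304241/1000000000000) * t^4"
    by (simp add: eval_nat_numeral field_simps)
  have "t^4 \<le> t^3" using assms by (intro power_decreasing) auto
  then show ?thesis unfolding e nsinc_majorant_def using t assms by linarith
qed

text \<open>The first side lobe has height about 0.217. From \<open>15/10\<close> on,
  \<open>\<bar>sin\<bar> \<le> 1\<close> is enough; before that, the sine becomes a cosine centred
  at \<open>15/10\<close> and is bounded by its Taylor polynomial.\<close>

lemma nsinc_tail:
  assumes "1 \<le> \<bar>x\<bar>"
  shows "\<bar>nsinc x\<bar> \<le> (22/100)"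
proof -
  have *: "\<bar>nsinc x\<bar> \<le> (22/100)" if x: "1 \<le> x" for x
  proof -
    have n: "\<bar>nsinc x\<bar> = \<bar>sin (pi * x)\<bar> / (pi * x)" using x by (simp add: nsinc_def)
    have "\<bar>sin (pi * x)\<bar> \<le> (22/100) * ((314157/100000) * x)"
    proof (cases "x \<le> (15/10)")
      case False
      then have "1 \<le> (22/100) * ((314157/100000) * x)" by simp
      then show ?thesis using abs_sin_le_one[of "pi * x"] by linarith
    next
      case True
      define v where "v = pi * ((15/10) - x)"
      have v: "0 \<le> v" "v \<le> pi / 2" using True x by (auto simp: v_def)
      have "pi * x = pi + (pi / 2 - v)" by (simp add: v_def algebra_simps)
      then have "sin (pi * x) = sin (pi + (pi / 2 - v))" by simp
      also have "\<dots> = - sin (pi / 2 - v)" by (rule sin_periodic_pi2)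
      also have "\<dots> = - cos v" by (simp add: sin_diff)
      finally have s: "\<bar>sin (pi * x)\<bar> = cos v" using v by (simp add: cos_ge_zero)
      have "cos v \<le> 1 - v^2/2 + v^4/24"
      proof -
        obtain r where "cos v = (\<Sum>m<4. cos_coeff m * v^m) + cos (r + 1/2 * real 4 * pi) / fact 4 * v^4"
          using Maclaurin_cos_expansion[of v 4] by auto
        moreover have "cos (r + 1/2 * real 4 * pi) / fact 4 * v^4 \<le> 1 / fact 4 * v^4"
          by (intro mult_right_mono divide_right_mono) auto
        moreover have "(\<Sum>m<4. cos_coeff m * v^m) = 1 - v^2/2"
        proof -
          have "{..<4} = {0, 1, 2, 3 :: nat}" by auto
          then show ?thesis by (simp only:) (simp add: cos_coeff_def fact_numeral)
        qed
        ultimately show ?thesis by (simp add: fact_numeral)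
      qed
      moreover have "v^4 \<le> (24675/10000) * v^2"
      proof -
        have "v^2 \<le> (pi/2)^2" using v by (intro power_mono) auto
        also have "\<dots> \<le> (24675/10000)" using pi_square_bounds by (simp add: power_divide)
        finally have "v^2 * v^2 \<le> (24675/10000) * v^2" by (intro mult_right_mono) auto
        then show ?thesis by (simp add: power4_eq_xxxx power2_eq_square mult.assoc)
      qed
      moreover have "x = (15/10) - v / pi" by (simp add: v_def)
      moreover have "v / pi \<le> v * (100000/314157)"
        using v divide_left_mono[of "314157/100000" pi v] pi_bounds by simp
      \<comment> \<open>\<open>28/100\<close> is close to the \<open>v\<close> at which the
        remaining quadratic inequality is tightest.\<close>
      moreover have "0 \<le> (v - (28/100))^2" by simp
      then have "(56/100) * v \<le> v^2 + (784/10000)" by (simp add: power2_eq_square algebra_simps)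
      ultimately show ?thesis unfolding s using zero_le_power2[of v] by linarith
    qed
    also have "\<dots> \<le> (22/100) * (pi * x)" using x pi_bounds by simp
    finally show ?thesis using x by (simp add: n pos_divide_le_eq)
  qed
  show ?thesis
    using *[of x] *[of "- x"] assms by (cases "x \<ge> 0") (auto simp: abs_if)
qed

text \<open>
  Each factor of the product formula is bounded by \<open>1 - y \<le> exp (- y)\<close>; the quartic term is the
  second-order gain in the factor \<open>k = 1\<close>.
\<close>

lemma nsinc_le_exp:
  assumes "\<bar>x\<bar> \<le> 1"
  shows "nsinc x \<le> exp (- (pi^2 / 6 * x^2 + x^4 / 2))"
proof (cases "x = 0")
  case False
  have lim: "(\<lambda>n. \<Prod>k=1..n. 1 - x^2 / real k^2) \<longlonglongrightarrow> nsinc x"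
    using sin_product_formula_real'[OF False] False by (simp add: nsinc_def)
  have x2: "x^2 \<le> 1" using assms by (simp add: abs_square_le_1)
  have fac: "0 \<le> 1 - x^2 / real k^2 \<and> 1 - x^2 / real k^2 \<le> exp (- (x^2 / real k^2 + (if k = 1 then x^4 / 2 else 0)))"
    if k: "k \<ge> 1" for k
  proof -
    let ?y = "x^2 / real k^2"
    have "1 \<le> real k^2" using k by (simp add: one_le_power)
    then have y: "0 \<le> ?y" "?y \<le> 1" using x2 by (simp_all add: divide_le_eq)
    show ?thesis
    proof (cases "k = 1")
      case True
      have "1 - x^2 \<le> exp (- (x^2 + (x^2)^2 / 2))"
      proof (cases "x^2 < 1")
        case True
        have "ln (1 + (- (x^2))) \<le> - (x^2) - (- (x^2))^2 / 2 + (- (x^2))^3 / 3"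
          using True by (intro ln_one_plus_le_cubic) simp
        also have "\<dots> \<le> - (x^2 + (x^2)^2 / 2)" by simp
        finally have "exp (ln (1 + - (x^2))) \<le> exp (- (x^2 + (x^2)^2 / 2))" by (simp only: exp_le_cancel_iff)
        moreover have "0 < 1 + - (x^2)" using True by simp
        ultimately show ?thesis by (simp only: exp_ln diff_conv_add_uminus)
      qed (use x2 in simp)
      then show ?thesis using True y by (simp flip: power_mult)
    next
      case False
      then show ?thesis using y exp_ge_add_one_self[of "- ?y"] by simp
    qed
  qed
  have le: "(\<Prod>k=1..n. 1 - x^2 / real k^2) \<le> exp (- (x^2 * (\<Sum>k=1..n. 1 / real k^2) + x^4 / 2))" if n: "n \<ge> 1" for n
  proof -
    have "(\<Prod>k=1..n. 1 - x^2 / real k^2) \<le> (\<Prod>k=1..n. exp (- (x^2 / real k^2 + (if k = 1 then x^4 / 2 else 0))))"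
      using fac by (intro prod_mono) auto
    also have "\<dots> = exp (- (\<Sum>k=1..n. x^2 / real k^2 + (if k = 1 then x^4 / 2 else 0)))"
      by (simp only: exp_sum[symmetric, OF finite_atLeastAtMost] sum_negf)
    also have "(\<Sum>k=1..n. x^2 / real k^2 + (if k = 1 then x^4 / 2 else 0)) = x^2 * (\<Sum>k=1..n. 1 / real k^2) + x^4 / 2"
      using n by (simp add: sum.distrib sum_distrib_left sum.delta)
    finally show ?thesis .
  qed
  have lim': "(\<lambda>n. exp (- (x^2 * (\<Sum>k=1..n. 1 / real k^2) + x^4 / 2))) \<longlonglongrightarrow> exp (- (x^2 * (pi^2 / 6) + x^4 / 2))"
  proof (intro tendsto_intros)
    have "(\<lambda>n. \<Sum>k<n. 1 / real (k + 1)^2) \<longlonglongrightarrow> pi^2 / 6"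
      using inverse_squares_sums by (simp add: sums_def add.commute)
    moreover have "(\<Sum>k<n. 1 / real (k + 1)^2) = (\<Sum>k=1..n. 1 / real k^2)" for n
      by (rule sum.reindex_bij_witness[of _ "\<lambda>k. k - 1" Suc]) auto
    ultimately show "(\<lambda>n. \<Sum>k=1..n. 1 / real k^2) \<longlonglongrightarrow> pi^2 / 6" by simp
  qed
  have "nsinc x \<le> exp (- (x^2 * (pi^2 / 6) + x^4 / 2))"
    by (rule LIMSEQ_le[OF lim lim']) (intro exI[of _ 1] allI impI le)
  then show ?thesis by (subst mult.commute)
qed (simp add: nsinc_def)

subsection \<open>Moments of the normalized sinc function\<close>

text \<open>Integration by parts gives \<open>Si (2 * u) - (sin u)^2 / u\<close> as a primitive of
  \<open>(sin u / u)^2\<close>. Here it is rescaled by \<open>u = pi * x\<close>, with the quotient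
  written through \<open>nsinc\<close> so that the formula is also valid at 0.\<close>

definition nsinc_square_primitive :: "real \<Rightarrow> real" where
  "nsinc_square_primitive x = (Si (2 * (pi * x)) - pi * x * (nsinc x)^2) / pi"

lemma Si_0: "Si 0 = 0"
  using Si_neg[of 0] by simp

lemma powr_quarter_power4:
  fixes y :: real
  assumes "0 \<le> y"
  shows "(y^4) powr (1/4) = y"
proof (cases "y = 0")
  case False
  then have "y^4 = y powr 4" using assms powr_realpow[of y 4] by simp
  then have "(y^4) powr (1/4) = y powr (4 * (1/4))" by (simp only: powr_powr)
  then show ?thesis using assms by simp
qed simp

lemma DERIV_Si_minus_sinc:
  "((\<lambda>u. Si (2 * u) - u * (sinc u)^2) has_real_derivative (sinc u)^2) (at u)"
proof (cases "u = 0")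
  case True
  have "((\<lambda>u. u * (sinc u)^2) has_real_derivative 1) (at 0)"
  proof -
    have "(\<lambda>h. (sinc h)^2) \<midarrow>0\<rightarrow> (sinc 0)^2"
      using isCont_sinc[of 0] unfolding isCont_def by (rule tendsto_power)
    moreover have "(\<lambda>h. ((0 + h) * (sinc (0 + h))^2 - 0 * (sinc 0)^2) / h) \<midarrow>0\<rightarrow> (sinc 0)^2
        \<longleftrightarrow> (\<lambda>h. (sinc h)^2) \<midarrow>0\<rightarrow> (sinc 0)^2"
      by (rule LIM_equal) simp
    ultimately show ?thesis unfolding DERIV_def by simp
  qed
  moreover have "((\<lambda>u. Si (2 * u)) has_real_derivative sinc (2 * 0) * 2) (at 0)"
    by (rule DERIV_chain2[OF DERIV_Si]) (auto intro!: derivative_eq_intros)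
  ultimately have "((\<lambda>u. Si (2 * u) - u * (sinc u)^2) has_real_derivative sinc (2 * 0) * 2 - 1) (at 0)"
    by (intro DERIV_diff)
  then show ?thesis using True by simp
next
  case False
  have Si: "((\<lambda>u. Si (2 * u)) has_real_derivative sinc (2 * u) * 2) (at u)"
    by (rule DERIV_chain2[OF DERIV_Si]) (auto intro!: derivative_eq_intros)
  have "((\<lambda>u. (sin u)^2 / u) has_real_derivative (2 * sin u * cos u * u - (sin u)^2) / u^2) (at u)"
    using False by (auto intro!: derivative_eq_intros simp: power2_eq_square)
  from DERIV_diff[OF Si this]
  have "((\<lambda>u. Si (2 * u) - (sin u)^2 / u) has_real_derivative (sinc u)^2) (at u)"
  proof (rule DERIV_cong)
    show "sinc (2 * u) * 2 - (2 * sin u * cos u * u - (sin u)^2) / u^2 = (sinc u)^2"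
      using False by (simp add: sin_double) (simp add: field_simps power2_eq_square)
  qed
  then show ?thesis
    by (rule has_field_derivative_transform_within_open[where S = "- {0}"])
       (use False in \<open>auto simp: power2_eq_square\<close>)
qed

lemma DERIV_nsinc_square_primitive:
  "(nsinc_square_primitive has_real_derivative (nsinc x)^2) (at x)"
proof -
  have "((\<lambda>x. Si (2 * (pi * x)) - pi * x * (sinc (pi * x))^2) has_real_derivative (sinc (pi * x))^2 * pi) (at x)"
    by (rule DERIV_chain2[OF DERIV_Si_minus_sinc]) (auto intro!: derivative_eq_intros)
  from DERIV_cdivide[OF this, of pi] show ?thesis
    unfolding nsinc_square_primitive_def[abs_def] nsinc_def by simp
qed

lemma nsinc_square_primitive_at_top: "(nsinc_square_primitive \<longlongrightarrow> 1 / 2) at_top"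
proof -
  have pix: "filterlim (\<lambda>x. pi * x) at_top at_top"
    by (rule filterlim_tendsto_pos_mult_at_top[OF tendsto_const]) (auto simp: filterlim_ident)
  have "filterlim (\<lambda>x. 2 * (pi * x)) at_top at_top"
    by (rule filterlim_tendsto_pos_mult_at_top[OF tendsto_const _ pix]) simp
  then have Si: "((\<lambda>x. Si (2 * (pi * x))) \<longlongrightarrow> pi / 2) at_top"
    by (rule filterlim_compose[OF Si_at_top])
  have "((\<lambda>x. inverse (pi * x)) \<longlongrightarrow> 0) at_top"
    by (rule filterlim_compose[OF tendsto_inverse_0_at_top[OF filterlim_ident] pix])
  then have "((\<lambda>x. pi * x * (nsinc x)^2) \<longlongrightarrow> 0) at_top"
  proof (rule tendsto_0_le[where K = 1])
    show "\<forall>\<^sub>F x in at_top. norm (pi * x * (nsinc x)^2) \<le> norm (inverse (pi * x)) * 1"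
      using eventually_gt_at_top[of 0]
    proof eventually_elim
      case (elim x)
      have "pi * x * (nsinc x)^2 = (sin (pi * x))^2 * inverse (pi * x)"
        using elim by (simp add: nsinc_def power2_eq_square field_simps)
      moreover have "\<bar>(sin (pi * x))^2\<bar> \<le> 1" by (simp add: abs_square_le_1)
      ultimately show ?case
        using elim mult_right_mono[of "\<bar>(sin (pi * x))^2\<bar>" 1 "\<bar>inverse (pi * x)\<bar>"] by (simp add: abs_mult)
    qed
  qed
  from tendsto_divide[OF tendsto_diff[OF Si this] tendsto_const[of pi]] show ?thesis
    by (simp add: nsinc_square_primitive_def[abs_def])
qed

lemma nn_integral_nsinc_square_atLeast:
  "(\<integral>\<^sup>+x. ennreal ((nsinc x)^2) * indicator {b..} x \<partial>lborel) = ennreal (1 / 2 - nsinc_square_primitive b)"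
  by (intro nn_integral_FTC_atLeast DERIV_nsinc_square_primitive nsinc_square_primitive_at_top) simp_all

lemma nsinc_nonneg: "0 \<le> x \<Longrightarrow> x \<le> 1 \<Longrightarrow> 0 \<le> nsinc x"
  by (auto simp: nsinc_def intro!: divide_nonneg_nonneg sin_ge_zero)

text \<open>
  The polynomial \<open>?g\<close> in the proof is \<open>q\<^sup>2 - 2 q d\<close>, where \<open>q\<close> is the majorant of \<open>nsinc\<close> and \<open>d\<close> bounds the error.
\<close>

lemma nsinc_square_primitive_1: "45125/100000 \<le> nsinc_square_primitive 1"
proof -
  let ?G = "\<lambda>x::real. x - 4113/3750 * x^3 + 86605659/100000000 * x^5 - 19078417/43750000 * x^7 + 33332463/225000000 * x^9 - 386619/11000000 * x^11 + 7435873/1300000000 * x^13 - 223119/375000000 * x^15 + 13013/425000000 * x^17"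
  let ?g = "\<lambda>x::real. 1 - 4113/1250 * x^2 + 86605659/20000000 * x^4 - 19078417/6250000 * x^6 + 33332463/25000000 * x^8 - 386619/1000000 * x^10 + 7435873/100000000 * x^12 - 223119/25000000 * x^14 + 13013/25000000 * x^16"
  have G: "(?G has_real_derivative ?g x) (at x)" for x
    by (auto intro!: derivative_eq_intros)
  have g: "?g x \<le> (nsinc x)^2" if x: "0 \<le> x" "x \<le> 1" for x
  proof -
    let ?q = "nsinc_majorant (x^2)" and ?d = "3/10000 * x^2 + 52/10000 * x^8"
    have b: "nsinc x \<le> ?q" "?q - nsinc x \<le> ?d" "0 \<le> nsinc x"
      using nsinc_bounds[of x] nsinc_nonneg[of x] x by auto
    have "?g x = ?q^2 - ?d * (2 * ?q)"
      unfolding nsinc_majorant_def by algebra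
    also have "\<dots> \<le> ?q^2 - (?q - nsinc x) * (?q + nsinc x)"
      using b by (intro diff_left_mono mult_mono) auto
    also have "\<dots> = (nsinc x)^2" by algebra
    finally show ?thesis .
  qed
  have "nsinc_square_primitive 0 - ?G 0 \<le> nsinc_square_primitive 1 - ?G 1"
  proof (rule DERIV_nonneg_imp_nondecreasing[of 0 1 "\<lambda>x. nsinc_square_primitive x - ?G x"])
    fix x :: real assume x: "0 \<le> x" "x \<le> 1"
    have "((\<lambda>x. nsinc_square_primitive x - ?G x) has_real_derivative (nsinc x)^2 - ?g x) (at x)"
      by (rule DERIV_diff[OF DERIV_nsinc_square_primitive G])
    then show "\<exists>y. ((\<lambda>x. nsinc_square_primitive x - ?G x) has_real_derivative y) (at x) \<and> 0 \<le> y"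
      using g[OF x] by (intro exI[of _ "(nsinc x)^2 - ?g x"]) simp
  qed simp
  moreover have "nsinc_square_primitive 0 = 0" by (simp add: nsinc_square_primitive_def Si_0)
  ultimately show ?thesis by simp
qed

lemma nn_integral_even:
  fixes f :: "real \<Rightarrow> ennreal"
  assumes [measurable]: "f \<in> borel_measurable borel" and even: "\<And>x. f (- x) = f x"
  shows "(\<integral>\<^sup>+x. f x \<partial>lborel) = 2 * (\<integral>\<^sup>+x. f x * indicator {0..} x \<partial>lborel)"
proof -
  have "(\<integral>\<^sup>+x. f x \<partial>lborel) = (\<integral>\<^sup>+x. f x * indicator {0..} x + f x * indicator {..0} x \<partial>lborel)"
  proof (rule nn_integral_cong_AE)
    show "AE x in lborel. f x = f x * indicator {0..} x + f x * indicator {..0} x"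
      using AE_lborel_singleton[of "0::real"] by eventually_elim (auto simp: indicator_def)
  qed
  also have "\<dots> = (\<integral>\<^sup>+x. f x * indicator {0..} x \<partial>lborel) + (\<integral>\<^sup>+x. f x * indicator {..0} x \<partial>lborel)"
    by (rule nn_integral_add) auto
  also have "(\<integral>\<^sup>+x. f x * indicator {..0} x \<partial>lborel) = (\<integral>\<^sup>+x. f x * indicator {0..} x \<partial>lborel)"
  proof -
    have "indicator {..0} (- x) = (indicator {0..} x :: ennreal)" for x :: real
      by (simp add: indicator_def)
    then show ?thesis
      using nn_integral_real_affine[of "\<lambda>x. f x * indicator {..0} x" "-1" 0] by (simp add: even)
  qed
  finally show ?thesis by (simp add: mult_2)
qed

lemma nsinc_moment_2: "nsinc_moment 2 = 1"
proof -
  have "nsinc_moment 2 = (\<integral>\<^sup>+x. ennreal ((nsinc x)^2) \<partial>lborel)"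
    by (simp add: nsinc_moment_def powr_numeral)
  also have "\<dots> = 2 * (\<integral>\<^sup>+x. ennreal ((nsinc x)^2) * indicator {0..} x \<partial>lborel)"
    by (rule nn_integral_even) auto
  also have "\<dots> = ennreal 2 * ennreal (1 / 2)"
    by (subst nn_integral_nsinc_square_atLeast) (simp add: nsinc_square_primitive_def Si_0)
  also have "\<dots> = 1" by (subst ennreal_mult[symmetric]) auto
  finally show ?thesis .
qed

text \<open>Beyond 1 all but two powers of \<open>\<bar>nsinc x\<bar>\<close> are bounded by
  \<open>22/100\<close>, and the square has a known primitive. The factor \<open>975/10000\<close>
  is \<open>2 * (1/2 - 45125/100000)\<close>, the two-sided tail of the square.\<close>

lemma nsinc_moment_le_split:
  assumes p: "2 \<le> p" and A: "0 \<le> A"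
    and le: "(\<integral>\<^sup>+x. ennreal (\<bar>nsinc x\<bar> powr p) * indicator {0..1} x \<partial>lborel) \<le> ennreal (A / 2)"
  shows "nsinc_moment p \<le> ennreal (A + (22/100) powr (p - 2) * (975/10000))"
proof -
  let ?f = "\<lambda>x. ennreal (\<bar>nsinc x\<bar> powr p)" and ?c = "(22/100) powr (p - 2) :: real"
  have "nsinc_moment p = 2 * (\<integral>\<^sup>+x. ?f x * indicator {0..} x \<partial>lborel)"
    unfolding nsinc_moment_def by (rule nn_integral_even) auto
  also have "(\<integral>\<^sup>+x. ?f x * indicator {0..} x \<partial>lborel)
      \<le> (\<integral>\<^sup>+x. ?f x * indicator {0..1} x + ennreal ?c * (ennreal ((nsinc x)^2) * indicator {1..} x) \<partial>lborel)"
  proof (rule nn_integral_mono)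
    fix x :: real
    have "?f x \<le> ennreal ?c * ennreal ((nsinc x)^2)" if "1 \<le> x"
    proof -
      have "\<bar>nsinc x\<bar> powr p = \<bar>nsinc x\<bar> powr (p - 2) * \<bar>nsinc x\<bar> powr 2"
        by (subst powr_add[symmetric]) simp
      also have "\<dots> \<le> ?c * \<bar>nsinc x\<bar> powr 2"
        using nsinc_tail[of x] that p by (intro mult_right_mono powr_mono2) auto
      also have "\<bar>nsinc x\<bar> powr 2 = (nsinc x)^2" by (simp add: powr_numeral)
      finally show ?thesis by (simp add: ennreal_mult[symmetric] ennreal_leI)
    qed
    then show "?f x * indicator {0..} x
        \<le> ?f x * indicator {0..1} x + ennreal ?c * (ennreal ((nsinc x)^2) * indicator {1..} x)"
      by (cases "x \<le> 1") (auto simp: indicator_def)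
  qed
  also have "\<dots> = (\<integral>\<^sup>+x. ?f x * indicator {0..1} x \<partial>lborel) + ennreal ?c * ennreal (1 / 2 - nsinc_square_primitive 1)"
    by (subst nn_integral_add) (auto simp: nn_integral_cmult nn_integral_nsinc_square_atLeast)
  also have "\<dots> \<le> ennreal (A / 2) + ennreal ?c * ennreal (4875/100000)"
    using nsinc_square_primitive_1 by (intro add_mono le mult_left_mono ennreal_leI) auto
  also have "ennreal ?c * ennreal (4875/100000) = ennreal (?c * (4875/100000))"
    by (rule ennreal_mult[symmetric]) simp_all
  also have "ennreal (A / 2) + ennreal (?c * (4875/100000)) = ennreal (A / 2 + ?c * (4875/100000))"
    using A by (intro ennreal_plus[symmetric]) simp_all
  finally have "nsinc_moment p \<le> 2 * ennreal (A / 2 + ?c * (4875/100000))"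
    by (simp add: mult_left_mono)
  also have "\<dots> = ennreal (2 * (A / 2 + ?c * (4875/100000)))"
    using A by (subst ennreal_mult) auto
  finally show ?thesis by (simp add: algebra_simps)
qed

text \<open>Splitting the power as a square times a fourth root, each with a polynomial majorant,
  makes the integral over \<open>[0, 1]\<close> elementary. The target is well below
  \<open>sqrt (8/9)\<close>, about 0.9428, which Ball's inequality would give.\<close>

lemma nsinc_moment_9_4: "nsinc_moment (9/4) \<le> ennreal (9284/10000)"
proof -
  \<comment> \<open>\<open>?g\<close> is the product of the two majorants multiplied out (see
    \<open>gQ\<close>), \<open>?G\<close> its primitive.\<close>
  let ?G = "\<lambda>x::real. x - 2313/1875 * x^3 + 568140381/500000000 * x^5 - 483140030011/700000000000 * x^7 + 64949515301/225000000000 * x^9 - 9559218651/110000000000 * x^11 + 621814417/32500000000 * x^13 - 898788719/300000000000 * x^15 + 132529111/425000000000 * x^17 - 8404539/475000000000 * x^19"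
  let ?g = "\<lambda>x::real. 1 - 2313/625 * x^2 + 568140381/100000000 * x^4 - 483140030011/100000000000 * x^6 + 64949515301/25000000000 * x^8 - 9559218651/10000000000 * x^10 + 621814417/2500000000 * x^12 - 898788719/20000000000 * x^14 + 132529111/25000000000 * x^16 - 8404539/25000000000 * x^18"
  have G: "(?G has_real_derivative ?g x) (at x)" for x
    by (auto intro!: derivative_eq_intros)
  have gQ: "?g x = (nsinc_majorant (x^2))^2 * (1 - 411/1000 * x^2)" for x
    unfolding nsinc_majorant_def by algebra
  have fg: "\<bar>nsinc x\<bar> powr (9/4) \<le> ?g x" if x: "0 \<le> x" "x \<le> 1" for x
  proof -
    have x2: "0 \<le> x^2" "x^2 \<le> 1" using x by (auto simp: abs_square_le_1)
    have b: "nsinc x \<le> nsinc_majorant (x^2)" "0 \<le> nsinc x"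
      using nsinc_bounds[of x] nsinc_nonneg[of x] x by auto
    have "nsinc x powr (1/4) \<le> ((1 - 411/1000 * x^2)^4) powr (1/4)"
      using b nsinc_majorant_le_fourth_power[OF x2] by (intro powr_mono2) auto
    also have "\<dots> = 1 - 411/1000 * x^2"
      using x2 by (intro powr_quarter_power4) simp
    finally have q: "nsinc x powr (1/4) \<le> 1 - 411/1000 * x^2" .
    have "\<bar>nsinc x\<bar> powr (9/4) = nsinc x powr (2 + 1/4)" using b by simp
    also have "\<dots> = (nsinc x)^2 * nsinc x powr (1/4)"
      using b by (simp only: powr_add powr_numeral)
    also have "\<dots> \<le> (nsinc_majorant (x^2))^2 * (1 - 411/1000 * x^2)"
      using b q by (intro mult_mono power_mono) auto
    finally show ?thesis by (simp only: gQ)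
  qed
  have "(\<integral>\<^sup>+x. ennreal (\<bar>nsinc x\<bar> powr (9/4)) * indicator {0..1} x \<partial>lborel)
      \<le> (\<integral>\<^sup>+x. ennreal (?g x) * indicator {0..1} x \<partial>lborel)"
  proof (rule nn_integral_mono)
    fix x :: real
    show "ennreal (\<bar>nsinc x\<bar> powr (9/4)) * indicator {0..1} x \<le> ennreal (?g x) * indicator {0..1} x"
      using fg[of x] by (cases "0 \<le> x \<and> x \<le> 1") (auto intro!: ennreal_leI simp: indicator_def)
  qed
  also have "\<dots> = ennreal (?G 1 - ?G 0)"
  proof (rule nn_integral_FTC_Icc)
    show "?g \<in> borel_measurable borel" by measurable
    show "(?G has_real_derivative ?g x) (at x)" for x by (rule G)
    show "0 \<le> ?g x" if "x \<in> {0..1}" for x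
    proof -
      have "\<bar>nsinc x\<bar> powr (9/4) \<le> ?g x" using that by (intro fg) auto
      then show ?thesis using powr_ge_zero[of "\<bar>nsinc x\<bar>" "9/4"] by (rule order_trans[rotated])
    qed
  qed simp
  also have "\<dots> \<le> ennreal ((8616/10000) / 2)"
    by (rule ennreal_leI) simp
  finally have "nsinc_moment (9/4) \<le> ennreal (8616/10000 + (22/100) powr (9/4 - 2) * (975/10000))"
    by (intro nsinc_moment_le_split) simp_all
  also have "\<dots> \<le> ennreal (9284/10000)"
  proof (rule ennreal_leI)
    \<comment> \<open>\<open>685/1000\<close> is the fourth root of \<open>22/100\<close>, rounded
      up.\<close>
    have "(22/100) powr (1/4) \<le> ((685/1000)^4) powr (1/4 :: real)"
      by (intro powr_mono2) (simp_all add: power_divide)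
    also have "\<dots> = (685/1000 :: real)"
      by (rule powr_quarter_power4) simp
    finally show "8616/10000 + (22/100) powr (9/4 - 2) * (975/10000) \<le> (9284/10000 :: real)"
      by simp
  qed
  finally show ?thesis .
qed

lemma exp_minus_le_quadratic:
  fixes y :: real
  assumes "0 \<le> y"
  shows "exp (- y) \<le> 1 - y + y^2 / 2"
proof -
  let ?g = "\<lambda>y::real. 1 - y + y^2 / 2 - exp (- y)"
  have "?g 0 \<le> ?g y"
  proof (rule DERIV_nonneg_imp_nondecreasing[OF assms])
    fix x :: real assume "0 \<le> x"
    have "(?g has_real_derivative (- 1 + x + exp (- x))) (at x)"
      by (auto intro!: derivative_eq_intros)
    moreover have "0 \<le> - 1 + x + exp (- x)" using exp_ge_add_one_self[of "- x"] by linarith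
    ultimately show "\<exists>d. (?g has_real_derivative d) (at x) \<and> 0 \<le> d" by blast
  qed
  then show ?thesis by simp
qed

text \<open>The exponential is a multiple of the normal density with variance
  \<open>3 / (p * pi^2)\<close>, so only the fourth and eighth normal moments enter.\<close>

lemma Gaussian_quartic_integral:
  fixes p :: real
  assumes p: "0 < p"
  shows "(\<integral>\<^sup>+x. ennreal (exp (- p * (pi^2/6) * x^2) * (1 - p * x^4 / 2 + p^2 * x^8 / 8)) \<partial>lborel)
       = ennreal (sqrt (6 / (pi * p)) * (1 - 27 / (2 * pi^4 * p) + 8505 / (8 * pi^8 * p^2)))"
proof -
  define s where "s = sqrt (3 / (p * pi^2))"
  have s: "0 < s" using p by (simp add: s_def)
  have s2: "s^2 = 3 / (p * pi^2)" using p by (simp add: s_def)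
  have s4: "s^4 = 9 / (p^2 * pi^4)"
    using arg_cong[OF s2, of "\<lambda>y. y^2"] by (simp add: power_divide power_mult_distrib flip: power_mult)
  have s8: "s^8 = 81 / (p^4 * pi^8)"
    using arg_cong[OF s4, of "\<lambda>y. y^2"] by (simp add: power_divide power_mult_distrib flip: power_mult)
  have root: "sqrt (2 * pi * s^2) = sqrt (6 / (pi * p))"
    unfolding s2 by (simp add: power2_eq_square mult_ac)
  have dens: "normal_density 0 s x = exp (- p * (pi^2/6) * x^2) / sqrt (6 / (pi * p))" for x
    unfolding normal_density_def root using p by (simp add: s2 field_simps)
  have m0: "has_bochner_integral lborel (normal_density 0 s) 1"
    using normal_moment_even[OF s, of 0 0] by simp
  have m4: "has_bochner_integral lborel (\<lambda>x. normal_density 0 s x * x^4) (3 * s^4)"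
    using normal_moment_even[OF s, of 0 2] by (simp add: fact_numeral power_divide flip: power_mult)
  have m8: "has_bochner_integral lborel (\<lambda>x. normal_density 0 s x * x^8) (105 * s^8)"
    using normal_moment_even[OF s, of 0 4] by (simp add: fact_numeral power_divide flip: power_mult)
  have "has_bochner_integral lborel
      (\<lambda>x. sqrt (6 / (pi * p)) * (normal_density 0 s x - p / 2 * (normal_density 0 s x * x^4) + p^2 / 8 * (normal_density 0 s x * x^8)))
      (sqrt (6 / (pi * p)) * (1 - p / 2 * (3 * s^4) + p^2 / 8 * (105 * s^8)))"
    by (intro has_bochner_integral_mult_right has_bochner_integral_add has_bochner_integral_diff m0 m4 m8)
  also have "(\<lambda>x. sqrt (6 / (pi * p)) * (normal_density 0 s x - p / 2 * (normal_density 0 s x * x^4) + p^2 / 8 * (normal_density 0 s x * x^8)))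
      = (\<lambda>x. exp (- p * (pi^2/6) * x^2) * (1 - p * x^4 / 2 + p^2 * x^8 / 8))"
  proof
    fix x
    have E: "sqrt (6 / (pi * p)) * normal_density 0 s x = exp (- p * (pi^2/6) * x^2)"
      unfolding dens using p by simp
    have "r * (N - p / 2 * (N * u) + p^2 / 8 * (N * v)) = (r * N) * (1 - p * u / 2 + p^2 * v / 8)" for r N u v :: real
      by (simp add: algebra_simps)
    then show "sqrt (6 / (pi * p)) * (normal_density 0 s x - p / 2 * (normal_density 0 s x * x^4) + p^2 / 8 * (normal_density 0 s x * x^8))
      = exp (- p * (pi^2/6) * x^2) * (1 - p * x^4 / 2 + p^2 * x^8 / 8)"
      by (simp only: E)
  qed
  also have "1 - p / 2 * (3 * s^4) + p^2 / 8 * (105 * s^8) = 1 - 27 / (2 * pi^4 * p) + 8505 / (8 * pi^8 * p^2)"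
  proof -
    have "p / 2 * (3 * s^4) = 27 / (2 * pi^4 * p)"
      unfolding s4 using p by (simp add: power2_eq_square)
    moreover have "p^2 / 8 * (105 * s^8) = 8505 / (8 * pi^8 * p^2)"
    proof -
      have "p^2 / 8 * (105 * s^8) = p^2 * 8505 / (8 * (p^4 * pi^8))"
        unfolding s8 by simp
      also have "\<dots> = 8505 / (8 * pi^8 * p^2)"
      proof (rule iffD2[OF frac_eq_eq])
        show "p^2 * 8505 * (8 * pi^8 * p^2) = 8505 * (8 * (p^4 * pi^8))" by algebra
      qed (use p in simp_all)
      finally show ?thesis .
    qed
    ultimately show ?thesis by (simp only:)
  qed
  finally have I: "has_bochner_integral lborel (\<lambda>x. exp (- p * (pi^2/6) * x^2) * (1 - p * x^4 / 2 + p^2 * x^8 / 8))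
      (sqrt (6 / (pi * p)) * (1 - 27 / (2 * pi^4 * p) + 8505 / (8 * pi^8 * p^2)))" .
  have nonneg: "0 \<le> 1 - p * x^4 / 2 + p^2 * x^8 / 8" for x :: real
  proof -
    define y where "y = p * x^4"
    have "0 \<le> (1 - y / 4)^2 + y^2 / 16" by simp
    also have "\<dots> = 1 - y / 2 + y^2 / 8" by (simp add: power2_eq_square algebra_simps)
    also have "y^2 = p^2 * x^8" by (simp add: y_def power_mult_distrib flip: power_mult)
    finally show ?thesis by (simp only: y_def)
  qed
  have "(\<integral>\<^sup>+x. ennreal (exp (- p * (pi^2/6) * x^2) * (1 - p * x^4 / 2 + p^2 * x^8 / 8)) \<partial>lborel)
      = ennreal (\<integral>x. exp (- p * (pi^2/6) * x^2) * (1 - p * x^4 / 2 + p^2 * x^8 / 8) \<partial>lborel)"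
    by (intro nn_integral_eq_integral integrable.intros[OF I] AE_I2 mult_nonneg_nonneg nonneg) simp
  then show ?thesis by (simp only: has_bochner_integral_integral_eq[OF I])
qed

text \<open>The leading factor is \<open>sqrt (6 / (pi * p)) = sqrt (2 / p) * sqrt (3 / pi)\<close>,
  and \<open>sqrt (3 / pi)\<close> alone is below \<open>exp (- (225/10000))\<close> for every
  \<open>p\<close>. The quartic correction gains about \<open>1/10 * (1 / p)\<close> relative to it,
  more than the tail beyond 1 costs.\<close>

lemma nsinc_moment_large:
  assumes p: "3 \<le> p"
  shows "nsinc_moment p \<le> ennreal (sqrt (2 * (1 / p)) * exp (- (225/10000)))"
proof -
  define A where "A = sqrt (6 / (pi * p)) * (1 - 27 / (2 * pi^4 * p) + 8505 / (8 * pi^8 * p^2))"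
  define k where "k = 1 - 27 / (2 * pi^4 * p) + 8505 / (8 * pi^8 * p^2)"
  let ?h = "\<lambda>x. exp (- p * (pi^2/6) * x^2) * (1 - p * x^4 / 2 + p^2 * x^8 / 8)"
  \<comment> \<open>For \<open>p \<ge> 3\<close> the second-order term costs at most
    \<open>d/3\<close> of the gain \<open>c\<close>, and
    \<open>13858/100000 - 1121/30000 > 1012/10000\<close>.\<close>
  have k: "0 \<le> k" "k \<le> 1 - 1012/10000 * (1 / p)"
  proof -
    define c d where "c = 27 / (2 * pi^4)" and "d = 8505 / (8 * pi^8)"
    have P4: "97406/1000 < pi^4" "pi^4 < 97411/1000"
      using mult_strict_mono[OF pi_square_bounds(1) pi_square_bounds(1)]
        mult_strict_mono[OF pi_square_bounds(2) pi_square_bounds(2)]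
      by (auto simp: eval_nat_numeral)
    have P8: "94879/10 < pi^8"
      using mult_strict_mono[OF P4(1) P4(1)] by (simp flip: power_add)
    have c: "13858/100000 \<le> c" "c \<le> 1"
      unfolding c_def using P4 by (simp_all add: field_simps)
    have d: "0 \<le> d" "d \<le> 1121/10000"
      unfolding d_def using P8 by (simp_all add: field_simps)
    have keq: "k = 1 - c * (1 / p) + d * ((1 / p) * (1 / p))"
      unfolding k_def c_def d_def by (simp add: power2_eq_square)
    have q: "0 < 1 / p" "1 / p \<le> 1 / 3" using p by (auto simp: field_simps)
    have "c * (1 / p) \<le> 1 * (1 / p)" using c q by (intro mult_right_mono) auto
    moreover have "0 \<le> d * ((1 / p) * (1 / p))" using d by simp
    ultimately show "0 \<le> k" unfolding keq using q by linarith
    have "13858/100000 * (1 / p) \<le> c * (1 / p)" using c q by (intro mult_right_mono) auto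
    moreover have "d * ((1 / p) * (1 / p)) \<le> 1121/10000 * ((1 / 3) * (1 / p))"
      using d q by (intro mult_mono mult_right_mono) auto
    ultimately show "k \<le> 1 - 1012/10000 * (1 / p)" unfolding keq using q by linarith
  qed
  have A0: "0 \<le> A" using k p unfolding A_def k_def by simp
  have "\<bar>nsinc x\<bar> powr p \<le> ?h x" if x: "0 \<le> x" "x \<le> 1" for x
  proof -
    have "nsinc x powr p \<le> exp (- (pi^2 / 6 * x^2 + x^4 / 2)) powr p"
      using nsinc_le_exp[of x] nsinc_nonneg[of x] x p by (intro powr_mono2) auto
    also have "\<dots> = exp (- p * (pi^2/6) * x^2) * exp (- (p * x^4 / 2))"
      by (simp add: powr_def mult_exp_exp algebra_simps)
    also have "\<dots> \<le> exp (- p * (pi^2/6) * x^2) * (1 - p * x^4 / 2 + (p * x^4 / 2)^2 / 2)"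
      using p by (intro mult_left_mono exp_minus_le_quadratic) auto
    also have "(p * x^4 / 2)^2 / 2 = p^2 * x^8 / 8"
      by (simp add: power_divide power_mult_distrib flip: power_mult)
    finally show ?thesis using nsinc_nonneg[of x] x by simp
  qed
  then have "(\<integral>\<^sup>+x. ennreal (\<bar>nsinc x\<bar> powr p) * indicator {0..1} x \<partial>lborel)
      \<le> (\<integral>\<^sup>+x. ennreal (?h x) * indicator {0..} x \<partial>lborel)"
    by (intro nn_integral_mono) (auto simp: indicator_def intro!: ennreal_leI)
  moreover have "\<dots> \<le> ennreal (A / 2)"
  proof -
    have "ennreal 2 * (\<integral>\<^sup>+x. ennreal (?h x) * indicator {0..} x \<partial>lborel) = (\<integral>\<^sup>+x. ennreal (?h x) \<partial>lborel)"
      by (subst nn_integral_even[of "\<lambda>x. ennreal (?h x)"]) auto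
    also have "\<dots> = ennreal A"
      unfolding A_def using p by (intro Gaussian_quartic_integral) simp
    also have "\<dots> = ennreal 2 * ennreal (A / 2)"
      using A0 by (subst ennreal_mult[symmetric]) simp_all
    finally show ?thesis by (subst (asm) ennreal_mult_cancel_left) auto
  qed
  ultimately have "nsinc_moment p \<le> ennreal (A + (22/100) powr (p - 2) * (975/10000))"
    using p A0 by (intro nsinc_moment_le_split) (auto intro: order_trans)
  also have "\<dots> \<le> ennreal (sqrt (2 * (1 / p)) * exp (- (225/10000)))"
  proof (rule ennreal_leI)
    let ?r = "sqrt (2 * (1 / p))"
    have r: "0 < ?r" using p by simp
    have "A \<le> ?r * (97722/100000 * (1 - 1012/10000 * (1 / p)))"
    proof -
      have "sqrt (3 / pi) \<le> 97722/100000"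
      proof (rule real_le_lsqrt)
        have "3 / pi \<le> 3 / (314157/100000)" using pi_bounds by (intro divide_left_mono) auto
        also have "\<dots> \<le> (97722/100000)^2" by (simp add: power_divide)
        finally show "3 / pi \<le> (97722/100000)^2" .
      qed simp
      moreover have "sqrt (6 / (pi * p)) = ?r * sqrt (3 / pi)"
        by (simp add: real_sqrt_mult[symmetric] mult.commute)
      ultimately have "sqrt (6 / (pi * p)) \<le> ?r * (97722/100000)"
        using r by (simp only: mult_le_cancel_left_pos)
      then have "sqrt (6 / (pi * p)) * k \<le> ?r * (97722/100000) * (1 - 1012/10000 * (1 / p))"
        using k r by (intro mult_mono) simp_all
      then show ?thesis by (simp only: A_def k_def mult.assoc)
    qed
    \<comment> \<open>The exponential decay is weakened to \<open>9 / p^2\<close>; one factor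
      \<open>1 / p\<close> is kept and the other is traded for \<open>41/100 * ?r\<close>, which
      exceeds it for \<open>p \<ge> 3\<close>.\<close>
    moreover have "(22/100) powr (p - 2) * (975/10000) \<le> ?r * (8/100 * (1 / p))"
    proof -
      have "(22/100) powr (p - 2) = 22/100 * (22/100) powr (p - 3)"
        using powr_add[of "22/100" 1 "p - 3"] by simp
      also have "(22/100) powr (p - 3) \<le> exp (-1) powr (p - 3)"
      proof (rule powr_mono2)
        have "exp 1 \<le> (3 :: real)" using exp_le by simp
        then have "1 / 3 \<le> exp (-1 :: real)" by (simp add: exp_minus field_simps)
        then show "22/100 \<le> exp (-1 :: real)" by simp
      qed (use p in auto)
      also have "exp (-1) powr (p - 3) = 1 / (exp ((p - 3) / 2))^2"
      proof -
        have "exp (-1) powr (p - 3) = inverse (exp (p - 3))" by (simp add: powr_def flip: exp_minus)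
        also have "exp (p - 3) = (exp ((p - 3) / 2))^2" by (subst exp_double[symmetric]) simp
        finally show ?thesis by (simp only: inverse_eq_divide)
      qed
      also have "\<dots> \<le> 1 / (p / 3)^2"
      proof (intro divide_left_mono power_mono)
        show "p / 3 \<le> exp ((p - 3) / 2)"
        proof -
          have "p / 3 \<le> 1 + (p - 3) / 2" using p by (simp add: field_simps)
          then show ?thesis using exp_ge_add_one_self[of "(p - 3) / 2"] by (rule order_trans)
        qed
      qed (use p in auto)
      finally have t: "(22/100) powr (p - 2) \<le> 22/100 * (1 / (p / 3)^2)" by simp
      have "1 / p \<le> 41/100 * ?r"
      proof (rule power2_le_imp_le)
        have "(1 / p)^2 \<le> (1 / p) * (1 / 3)"
          using p unfolding power2_eq_square by (intro mult_left_mono) (auto simp: field_simps)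
        also have "\<dots> \<le> (41/100)^2 * (2 * (1 / p))" using p by (simp add: power_divide field_simps)
        also have "\<dots> = (41/100 * ?r)^2"
          using p by (subst power_mult_distrib, subst real_sqrt_pow2) simp_all
        finally show "(1 / p)^2 \<le> (41/100 * ?r)^2" .
      qed (use r in simp)
      then have "1 / p * (1 / p) \<le> 41/100 * ?r * (1 / p)" using p by (intro mult_right_mono) auto
      then have "22/100 * (1 / (p / 3)^2) * (975/10000) \<le> 22/100 * (9 * (41/100 * ?r * (1 / p))) * (975/10000)"
        by (simp add: power2_eq_square)
      also have "\<dots> \<le> ?r * (8/100 * (1 / p))"
      proof -
        have gen: "22/100 * (9 * (41/100 * u * q)) * (975/10000) \<le> u * (8/100 * q)" if "0 \<le> u * q" for u q :: real
        proof -
          have "u * (8/100 * q) = 22/100 * (9 * (41/100 * u * q)) * (975/10000) + 1699/2000000 * (u * q)"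
            by algebra
          then show ?thesis using that by linarith
        qed
        show ?thesis by (rule gen) (use r p in simp)
      qed
      finally have "22/100 * (1 / (p / 3)^2) * (975/10000) \<le> ?r * (8/100 * (1 / p))" .
      moreover have "(22/100) powr (p - 2) * (975/10000) \<le> 22/100 * (1 / (p / 3)^2) * (975/10000)"
        by (rule mult_right_mono[OF t]) simp
      ultimately show ?thesis by (rule order_trans[rotated])
    qed
    ultimately have "A + (22/100) powr (p - 2) * (975/10000)
        \<le> ?r * (97722/100000 * (1 - 1012/10000 * (1 / p)) + 8/100 * (1 / p))"
      by (simp only: distrib_left)
    also have "\<dots> \<le> ?r * exp (- (225/10000))"
    proof (rule mult_left_mono)
      have "97722/100000 * (1 - 1012/10000 * (1 / p)) + 8/100 * (1 / p) \<le> 97722/100000"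
      proof -
        have "97722/100000 * (1 - 1012/10000 * q) + 8/100 * q \<le> 97722/100000" if "0 \<le> q" for q :: real
        proof -
          have "97722/100000 * (1 - 1012/10000 * q) + 8/100 * q = 97722/100000 - 18894664/1000000000 * q"
            by (simp add: right_diff_distrib diff_divide_distrib)
          then show ?thesis using that by simp
        qed
        from this[of "1 / p"] show ?thesis using p by simp
      qed
      also have "\<dots> \<le> exp (- (225/10000))"
        using exp_ge_add_one_self[of "- (225/10000) :: real"] by simp
      finally show "97722/100000 * (1 - 1012/10000 * (1 / p)) + 8/100 * (1 / p) \<le> exp (- (225/10000))" .
    qed (use r in simp)
    finally show "A + (22/100) powr (p - 2) * (975/10000) \<le> ?r * exp (- (225/10000))" .
  qed
  finally show ?thesis .
qed

subsection \<open>The gap in Ball's integral inequality\<close>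

text \<open>The comparison value is \<open>sqrt (2 / p) * exp (- m)\<close>, written as a single
  exponential so that interpolation between exponents acts affinely on its argument.\<close>

definition moment_gap :: "real \<Rightarrow> real \<Rightarrow> bool" where
  "moment_gap p m \<longleftrightarrow> nsinc_moment p \<le> ennreal (exp (ln (2 / p) / 2 - m))"

lemma sqrt_eq_exp: "0 < x \<Longrightarrow> sqrt x = exp (ln x / 2)"
  using exp_ln[of "sqrt x"] ln_sqrt[of x] by simp

text \<open>Log-convexity of the moments in \<open>p\<close>: Hoelder's inequality for two
  functions, indexed by \<open>bool\<close>.\<close>

lemma nsinc_moment_interpolate:
  assumes \<theta>: "0 \<le> \<theta>" "\<theta> \<le> 1"
    and p: "nsinc_moment p \<le> ennreal (exp A)" and q: "nsinc_moment q \<le> ennreal (exp B)"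
  shows "nsinc_moment ((1 - \<theta>) * p + \<theta> * q) \<le> ennreal (exp ((1 - \<theta>) * A + \<theta> * B))"
proof (cases "\<theta> = 0 \<or> \<theta> = 1")
  case True
  then show ?thesis using p q by auto
next
  case False
  define w where "w = (\<lambda>b. if b then \<theta> else 1 - \<theta>)"
  define C where "C = (\<lambda>b. if b then exp B else exp A)"
  define F where "F = (\<lambda>b x. \<bar>nsinc x\<bar> powr (if b then \<theta> * q else (1 - \<theta>) * p))"
  have "(\<integral>\<^sup>+x. ennreal (\<Prod>b\<in>UNIV. F b x) \<partial>lborel) \<le> ennreal (\<Prod>b\<in>UNIV. C b powr w b)"
  proof (rule nn_integral_Hoelder)
    show "(\<integral>\<^sup>+x. ennreal (F b x powr (1 / w b)) \<partial>lborel) \<le> ennreal (C b)" for b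
    proof (cases b)
      case True
      have "F b x powr (1 / w b) = \<bar>nsinc x\<bar> powr q" for x
        using True False by (simp add: F_def w_def powr_powr)
      then show ?thesis using True q by (simp add: nsinc_moment_def C_def)
    next
      case b: False
      have "F b x powr (1 / w b) = \<bar>nsinc x\<bar> powr p" for x
        using b False by (simp add: F_def w_def powr_powr)
      then show ?thesis using b p by (simp add: nsinc_moment_def C_def)
    qed
    show "F b \<in> borel_measurable lborel" for b unfolding F_def by measurable
  qed (use \<theta> False in \<open>auto simp: w_def C_def F_def UNIV_bool\<close>)
  moreover have "(\<Prod>b\<in>UNIV. F b x) = \<bar>nsinc x\<bar> powr ((1 - \<theta>) * p + \<theta> * q)" for x
    by (simp add: F_def UNIV_bool powr_add mult.commute)
  moreover have "(\<Prod>b\<in>UNIV. C b powr w b) = exp ((1 - \<theta>) * A + \<theta> * B)"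
    by (simp add: C_def w_def UNIV_bool powr_def exp_add mult.commute)
  ultimately show ?thesis by (simp only: nsinc_moment_def)
qed

lemma moment_gap_ge_3:
  assumes "3 \<le> p"
  shows "moment_gap p (225/10000)"
proof -
  have "sqrt (2 * (1 / p)) * exp (- (225/10000)) = exp (ln (2 / p) / 2 - 225/10000)"
    using assms sqrt_eq_exp[of "2 / p"] by (simp add: exp_diff exp_minus inverse_eq_divide)
  then show ?thesis
    using nsinc_moment_large[OF assms] unfolding moment_gap_def by (simp only:)
qed

lemma moment_gap_9_4: "moment_gap (9/4) (15/1000)"
proof -
  have "9428/10000 \<le> sqrt (8/9)"
    by (rule real_le_rsqrt) (simp add: power_divide)
  moreover have "985/1000 \<le> exp (- (15/1000) :: real)"
    using exp_ge_add_one_self[of "- (15/1000) :: real"] by simp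
  ultimately have "9428/10000 * (985/1000) \<le> sqrt (8/9) * exp (- (15/1000) :: real)"
    by (intro mult_mono) simp_all
  then have "9284/10000 \<le> sqrt (8/9) * exp (- (15/1000) :: real)" by simp
  also have "\<dots> = exp (ln (2 / (9/4)) / 2 - 15/1000)"
    using sqrt_eq_exp[of "8/9"] by (simp add: exp_diff exp_minus inverse_eq_divide)
  finally show ?thesis
    unfolding moment_gap_def using nsinc_moment_9_4 by (meson ennreal_leI order_trans)
qed

lemma moment_gap_2: "moment_gap 2 0"
  by (simp add: moment_gap_def nsinc_moment_2)

text \<open>The log-moment lies below its chord, while \<open>ln (2 / p) / 2\<close> lies above its
  tangent at 2. The slopes in \<open>\<theta>\<close> differ by at least
  \<open>1477/20000 - 1/16 > 11/1000\<close>, which is \<open>44/1000\<close> per unit of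
  \<open>p\<close>.\<close>

lemma moment_gap_2_to_9_4:
  assumes "2 \<le> p" "p \<le> 9/4"
  shows "moment_gap p (44/1000 * (p - 2))"
proof -
  define \<theta> where "\<theta> = 4 * (p - 2)"
  have \<theta>: "0 \<le> \<theta>" "\<theta> \<le> 1" using assms by (auto simp: \<theta>_def)
  have "(1 - \<theta>) * 2 + \<theta> * (9/4) = p" by (simp add: \<theta>_def algebra_simps)
  then have "nsinc_moment p \<le> ennreal (exp ((1 - \<theta>) * 0 + \<theta> * (ln (2 / (9/4)) / 2 - 15/1000)))"
    using nsinc_moment_interpolate[OF \<theta>, of 2 0 "9/4" "ln (2 / (9/4)) / 2 - 15/1000"] moment_gap_9_4
    by (simp add: moment_gap_def nsinc_moment_2)
  also have "\<dots> \<le> ennreal (exp (ln (2 / p) / 2 - 44/1000 * (p - 2)))"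
  proof -
    have l: "ln (2 / (9/4)) \<le> (- 1177/10000 :: real)"
      using ln_one_plus_le_cubic[of "- 1/9"] by (simp add: power_divide)
    have "ln (1 + \<theta>/8) \<le> \<theta>/8" using \<theta> by (intro ln_add_one_self_le_self) simp
    moreover have "ln (2 / p) = - ln (1 + \<theta>/8)"
    proof -
      have "1 + \<theta>/8 = inverse (2 / p)" using assms by (simp add: \<theta>_def field_simps)
      then show ?thesis using assms by (simp only: ln_inverse)
    qed
    moreover have "44/1000 * (p - 2) = 11/1000 * \<theta>" by (simp add: \<theta>_def)
    moreover define X where "X = \<theta> * (ln (2 / (9/4)) / 2 - 15/1000)"
    moreover have "X \<le> \<theta> * (- 1177/10000 / 2 - 15/1000)"
      unfolding X_def using \<theta> l by (intro mult_left_mono diff_right_mono divide_right_mono) auto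
    then have "X \<le> - (1477/20000 * \<theta>)" by simp
    ultimately have "(1 - \<theta>) * 0 + X \<le> ln (2 / p) / 2 - 44/1000 * (p - 2)"
      using \<theta> by linarith
    then show ?thesis unfolding X_def by (intro ennreal_leI) (simp only: exp_le_cancel_iff)
  qed
  finally show ?thesis unfolding moment_gap_def .
qed

text \<open>The chord of the log-moment is compared with the convex function
  \<open>ln (2 / p) / 2\<close>, which sags below its own chord; the sag is what lowers the gap from
  \<open>15/1000\<close> to \<open>115/10000\<close>.\<close>

lemma moment_gap_9_4_to_3:
  assumes "9/4 \<le> p" "p \<le> 3"
  shows "moment_gap p (115/10000)"
proof -
  define \<theta> where "\<theta> = 4/3 * (p - 9/4)"
  have \<theta>: "0 \<le> \<theta>" "\<theta> \<le> 1" using assms by (auto simp: \<theta>_def)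
  have pe: "(1 - \<theta>) * (9/4) + \<theta> * 3 = p" by (simp add: \<theta>_def algebra_simps)
  let ?A = "ln (2 / (9/4)) / 2 - 15/1000 :: real" and ?B = "ln (2 / 3) / 2 - 225/10000 :: real"
  have "nsinc_moment ((1 - \<theta>) * (9/4) + \<theta> * 3) \<le> ennreal (exp ((1 - \<theta>) * ?A + \<theta> * ?B))"
    using moment_gap_9_4 moment_gap_ge_3[of 3] unfolding moment_gap_def
    by (intro nsinc_moment_interpolate \<theta>) simp_all
  also have "\<dots> \<le> ennreal (exp (ln (2 / p) / 2 - 115/10000))"
  proof -
    define a where "a = (ln (8/9) :: real)"
    have l: "ln (3/4) \<le> (- 2864/10000 :: real)"
      using ln_one_plus_le_cubic[of "- 1/4"] by (simp add: power_divide)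
    have "(2 / 3 :: real) = (8/9) * (3/4)" by simp
    then have B: "ln (2 / 3 :: real) = a + ln (3/4)"
      unfolding a_def by (metis ln_mult_pos zero_less_divide_iff zero_less_numeral)
    have A: "ln (2 / (9/4) :: real) = a" by (simp add: a_def)
    have "2 / p = (8/9) / (1 + \<theta>/3)" using assms by (simp add: \<theta>_def field_simps)
    moreover have "ln ((8/9) / (1 + \<theta>/3)) = a - ln (1 + \<theta>/3)"
      unfolding a_def using \<theta> by (intro ln_divide_pos) auto
    ultimately have p2: "ln (2 / p) = a - ln (1 + \<theta>/3)" by (simp only:)
    have c: "ln (1 + \<theta>/3) \<le> \<theta>/3 - \<theta>^2/18 + \<theta>^3/81"
      using ln_one_plus_le_cubic[of "\<theta>/3"] \<theta> by (simp add: power_divide)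
    have "\<theta>^3 \<le> \<theta>^2" using \<theta> by (intro power_decreasing) auto
    \<comment> \<open>\<open>37/100\<close> is close to the \<open>\<theta>\<close> at which the
      inequality to be shown is tightest.\<close>
    moreover have "0 \<le> (\<theta> - 37/100)^2" by simp
    then have "74/100 * \<theta> \<le> \<theta>^2 + 1369/10000" by (simp add: power2_eq_square algebra_simps)
    moreover have "\<theta> * ln (3/4) \<le> \<theta> * (- 2864/10000)" using \<theta> l by (intro mult_left_mono) auto
    moreover have "(1 - \<theta>) * ?A + \<theta> * ?B = a / 2 - 15/1000 - 75/10000 * \<theta> + \<theta> * ln (3/4) / 2"
      unfolding A B by (simp add: field_simps)
    moreover have "T \<le> (a' - L) / 2 - 115/10000"
      if "T = a' / 2 - 15/1000 - 75/10000 * s + l / 2" "l \<le> s * (- 2864/10000)"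
        "L \<le> s/3 - s2/18 + s3/81" "s3 \<le> s2" "74/100 * s \<le> s2 + 1369/10000" "0 \<le> s"
      for T a' L l s s2 s3 :: real
      using that by (simp add: field_simps)
    ultimately have "(1 - \<theta>) * ?A + \<theta> * ?B \<le> ln (2 / p) / 2 - 115/10000"
      unfolding p2 using c \<theta>(1) by blast
    then show ?thesis by (intro ennreal_leI) simp
  qed
  finally show ?thesis unfolding moment_gap_def pe .
qed

text \<open>Unifies three ranges of the gap into one bound linear in the distance from
  \<open>1/2\<close>. The slope \<open>22/1000\<close> is dictated by \<open>w = 1/3\<close> in the
  middle range, where the gap contributes \<open>115/30000\<close> at distance
  \<open>1/6\<close>.\<close>

lemma moment_gap_heavy:
  assumes "29/100 \<le> w" "w \<le> 1/2"
  shows "\<exists>m. moment_gap (1 / w) m \<and> 22/1000 * (1/2 - w) \<le> w * m"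
proof -
  have w: "0 < w" using assms by simp
  consider "w \<le> 1/3" | "1/3 \<le> w" "w \<le> 4/9" | "4/9 \<le> w" by linarith
  then show ?thesis
  proof cases
    case 1
    then have "moment_gap (1 / w) (225/10000)" using w by (intro moment_gap_ge_3) (simp add: field_simps)
    then show ?thesis using assms by (intro exI[of _ "225/10000"]) auto
  next
    case 2
    then have "moment_gap (1 / w) (115/10000)" using w by (intro moment_gap_9_4_to_3) (simp_all add: field_simps)
    then show ?thesis using 2 by (intro exI[of _ "115/10000"]) auto
  next
    case 3
    then have "moment_gap (1 / w) (44/1000 * (1 / w - 2))"
      using w assms by (intro moment_gap_2_to_9_4) (simp_all add: field_simps)
    moreover have "w * (44/1000 * (1 / w - 2)) = 44/1000 * (1 - 2 * w)"
      using w by (simp add: field_simps)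
    ultimately show ?thesis using assms by (intro exI[of _ "44/1000 * (1 / w - 2)"]) auto
  qed
qed

subsection \<open>Stability\<close>

text \<open>
  The weights are \<open>W\<close> at \<open>k\<close> and, elsewhere, the numbers \<open>(a $ j)\<^sup>2\<close> rescaled to total weight \<open>1 - W\<close>.
\<close>

lemma cube_section_deficit:
  fixes a :: "real ^ 'n"
  assumes a: "norm a = 1" and \<epsilon>: "0 < \<epsilon>" "\<epsilon> < 1"
    and \<sigma>: "(1 - \<epsilon>) * sqrt 2 \<le> cube_section_volume a t"
    and k: "a $ k \<noteq> 0" and X: "X = (a $ k)\<^sup>2" "X < 1"
    and W: "0 < W" "W < 1" and c: "c = (1 - W) / (1 - X)"
    and gk: "moment_gap (1 / W) mk"
    and g: "\<And>j. j \<noteq> k \<Longrightarrow> a $ j \<noteq> 0 \<Longrightarrow> moment_gap (1 / (c * (a $ j)\<^sup>2)) (m j)"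
  shows "W * mk + (\<Sum>j\<in>UNIV - {k}. c * (a $ j)\<^sup>2 * m j)
       \<le> \<epsilon> / (1 - \<epsilon>) + (W * ln (W / X) + (1 - W) * ln ((1 - W) / (1 - X))) / 2"
proof -
  let ?S = "{j. a $ j \<noteq> 0}"
  define w where "w = (\<lambda>j. if j = k then W else c * (a $ j)\<^sup>2)"
  define m' where "m' = (\<lambda>j. if j = k then mk else m j)"
  have c0: "0 < c" using W X by (simp add: c)
  have sum1: "(\<Sum>j\<in>UNIV. (a $ j)\<^sup>2) = 1"
    using a by (simp add: norm_eq_1 inner_vec_def power2_eq_square)
  have rest: "(\<Sum>j\<in>?S - {k}. (a $ j)\<^sup>2) = 1 - X"
  proof -
    have "(\<Sum>j\<in>?S - {k}. (a $ j)\<^sup>2) = (\<Sum>j\<in>UNIV - {k}. (a $ j)\<^sup>2)"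
      by (rule sum.mono_neutral_left) auto
    also have "\<dots> = 1 - X" using sum1 X by (simp add: sum_diff1)
    finally show ?thesis .
  qed
  have split: "(\<Sum>j\<in>?S. h j) = h k + (\<Sum>j\<in>?S - {k}. h j)" for h :: "'n \<Rightarrow> real"
    by (rule sum.remove) (use k in auto)
  have w0: "0 < w j" if "a $ j \<noteq> 0" for j using that W c0 by (simp add: w_def)
  have cX: "c * (1 - X) = 1 - W" using X by (simp add: c)
  have wsum: "(\<Sum>j\<in>?S. w j) = 1"
  proof -
    have "(\<Sum>j\<in>?S - {k}. w j) = (\<Sum>j\<in>?S - {k}. c * (a $ j)\<^sup>2)"
      by (intro sum.cong) (auto simp: w_def)
    also have "\<dots> = 1 - W" by (simp only: sum_distrib_left[symmetric] rest cX)
    finally show ?thesis unfolding split by (simp add: w_def)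
  qed
  have gap: "nsinc_moment (1 / w j) \<le> ennreal (sqrt (2 * w j) * exp (- m' j))" if j: "a $ j \<noteq> 0" for j
  proof -
    have "moment_gap (1 / w j) (m' j)" using gk g j by (simp add: w_def m'_def)
    moreover have "exp (ln (2 / (1 / w j)) / 2 - m' j) = sqrt (2 * w j) * exp (- m' j)"
    proof -
      have "2 / (1 / w j) = 2 * w j" by simp
      then show ?thesis
        using sqrt_eq_exp[of "2 * w j"] w0[OF j] by (simp add: exp_diff exp_minus inverse_eq_divide)
    qed
    ultimately show ?thesis unfolding moment_gap_def by (simp only:)
  qed
  let ?E = "\<Sum>j\<in>?S. w j * (ln (w j / (a $ j)\<^sup>2) / 2 - m' j)"
  have "(1 - \<epsilon>) * sqrt 2 \<le> sqrt 2 * exp ?E"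
    using \<sigma> cube_section_volume_le_weights[OF a w0 wsum gap, where t = t] by linarith
  then have "1 - \<epsilon> \<le> exp ?E" by simp
  then have "ln (1 - \<epsilon>) \<le> ln (exp ?E)" using \<epsilon> by (subst ln_le_cancel_iff) simp_all
  then have "ln (1 - \<epsilon>) \<le> ?E" by (simp only: ln_exp)
  moreover have "- ln (1 - \<epsilon>) \<le> \<epsilon> / (1 - \<epsilon>)"
  proof -
    have "- ln (1 - \<epsilon>) = ln (1 / (1 - \<epsilon>))" using \<epsilon> by (simp add: ln_div)
    also have "\<dots> \<le> 1 / (1 - \<epsilon>) - 1" using \<epsilon> by (intro ln_le_minus_one) simp
    also have "\<dots> = \<epsilon> / (1 - \<epsilon>)" using \<epsilon> by (simp add: field_simps)
    finally show ?thesis .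
  qed
  moreover have "?E = (W * ln (W / X) + (1 - W) * ln ((1 - W) / (1 - X))) / 2
      - (W * mk + (\<Sum>j\<in>UNIV - {k}. c * (a $ j)\<^sup>2 * m j))"
  proof -
    \<comment> \<open>Off \<open>k\<close> the ratio of weight to squared component is the constant
      \<open>c\<close>, so the relative entropy collapses to that of a two-point
      distribution.\<close>
    have "(\<Sum>j\<in>?S - {k}. w j * (ln (w j / (a $ j)\<^sup>2) / 2 - m' j))
        = (\<Sum>j\<in>?S - {k}. (a $ j)\<^sup>2 * (c * (ln c / 2)) - c * (a $ j)\<^sup>2 * m j)"
      by (intro sum.cong refl) (auto simp: w_def m'_def algebra_simps)
    also have "\<dots> = (1 - X) * (c * (ln c / 2)) - (\<Sum>j\<in>?S - {k}. c * (a $ j)\<^sup>2 * m j)"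
      by (simp only: sum_subtractf sum_distrib_right[symmetric] rest)
    also have "(1 - X) * (c * (ln c / 2)) = (1 - W) * ln ((1 - W) / (1 - X)) / 2"
      using cX by (simp add: c[symmetric] mult.assoc[symmetric] mult.commute)
    also have "(\<Sum>j\<in>?S - {k}. c * (a $ j)\<^sup>2 * m j) = (\<Sum>j\<in>UNIV - {k}. c * (a $ j)\<^sup>2 * m j)"
      by (rule sum.mono_neutral_left) auto
    finally have "(\<Sum>j\<in>?S - {k}. w j * (ln (w j / (a $ j)\<^sup>2) / 2 - m' j))
        = (1 - W) * ln ((1 - W) / (1 - X)) / 2 - (\<Sum>j\<in>UNIV - {k}. c * (a $ j)\<^sup>2 * m j)" .
    moreover have "w k * (ln (w k / (a $ k)\<^sup>2) / 2 - m' k) = W * ln (W / X) / 2 - W * mk"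
      by (simp add: w_def m'_def X(1) right_diff_distrib)
    ultimately show ?thesis unfolding split by (simp add: add_divide_distrib)
  qed
  ultimately show ?thesis by linarith
qed

text \<open>
  The upper bound on \<open>X\<close> is what \<open>X \<le> 1 / (2 (1 - \<epsilon>)\<^sup>2)\<close> gives for \<open>\<epsilon> < 1/75\<close>.
\<close>

lemma relative_entropy_4_9:
  fixes X :: real
  assumes "4/9 \<le> X" "X \<le> 514/1000"
  shows "4/9 * ln (4/9 / X) + (1 - 4/9) * ln ((1 - 4/9) / (1 - X)) \<le> 99/10000"
proof -
  \<comment> \<open>The entropy grows as \<open>X\<close> moves up from \<open>4/9\<close>, so only
    this endpoint needs numbers. Monotonicity comes from \<open>ln y \<le> y - 1\<close> in both
    logarithms: claim 3 says that the resulting corrections add up to at most 0.\<close>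
  let ?Y = "514/1000 :: real"
  have pos: "0 < X" "0 < 1 - X" using assms by auto
  have 1: "ln (4/9 / X) \<le> ln (4/9 / ?Y) + (?Y / X - 1)"
  proof -
    have "4/9 / X = (4/9 / ?Y) * (?Y / X)" by simp
    then have "ln (4/9 / X) = ln (4/9 / ?Y) + ln (?Y / X)"
      using pos ln_mult_pos[of "4/9 / ?Y" "?Y / X"] by (simp only: divide_pos_pos zero_less_numeral)
    then show ?thesis using ln_le_minus_one[of "?Y / X"] pos by simp
  qed
  have "ln (5/9 / d) \<le> ln (5/9 / (1 - ?Y)) + ((1 - ?Y) / d - 1)" if d: "0 < d" for d
  proof -
    have "5/9 / d = (5/9 / (1 - ?Y)) * ((1 - ?Y) / d)" by simp
    then have "ln (5/9 / d) = ln (5/9 / (1 - ?Y)) + ln ((1 - ?Y) / d)"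
      using d ln_mult_pos[of "5/9 / (1 - ?Y)" "(1 - ?Y) / d"] by simp
    then show ?thesis using ln_le_minus_one[of "(1 - ?Y) / d"] d by simp
  qed
  from this[OF pos(2)] have 2: "ln (5/9 / (1 - X)) \<le> ln (5/9 / (1 - ?Y)) + ((1 - ?Y) / (1 - X) - 1)" .
  have 3: "4/9 * (?Y / X - 1) + 5/9 * ((1 - ?Y) / (1 - X) - 1) \<le> 0"
  proof -
    have e: "?Y / X - 1 = (?Y - X) / X" "(1 - ?Y) / (1 - X) - 1 = - ((?Y - X) / (1 - X))"
      using pos by (simp_all add: field_simps)
    moreover have "4/9 * ((?Y - X) / X) \<le> ?Y - X"
    proof -
      have "4/9 * (?Y - X) \<le> X * (?Y - X)" using assms by (intro mult_right_mono) auto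
      then show ?thesis using pos by (simp add: field_simps)
    qed
    moreover have "?Y - X \<le> 5/9 * ((?Y - X) / (1 - X))"
    proof -
      have "(?Y - X) * (1 - X) \<le> (?Y - X) * (5/9)" using assms by (intro mult_left_mono) auto
      then have "?Y - X \<le> (?Y - X) * (5/9) / (1 - X)" using pos(2) by (rule pos_le_divide_eq[THEN iffD2, rotated])
      also have "\<dots> = 5/9 * ((?Y - X) / (1 - X))" by (simp only: times_divide_eq_right mult.commute)
      finally show ?thesis .
    qed
    moreover have "4/9 * u + 5/9 * (- v) \<le> 0" if "4/9 * u \<le> d" "d \<le> 5/9 * v" for u v d :: real
      using that by linarith
    ultimately show ?thesis unfolding e by blast
  qed
  have 4: "ln (4/9 / ?Y) \<le> - (1453/10000)"
    using ln_one_plus_le_cubic[of "4/9 / ?Y - 1"] by (simp add: power_divide)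
  have 5: "ln (5/9 / (1 - ?Y)) \<le> 1339/10000"
    using ln_one_plus_le_cubic[of "5/9 / (1 - ?Y) - 1"] by (simp add: power_divide)
  have "(1 - 4/9 :: real) = 5/9" by simp
  moreover have "4/9 * u + 5/9 * v \<le> 99/10000"
    if "u \<le> u' + p" "v \<le> v' + q" "4/9 * p + 5/9 * q \<le> 0" "u' \<le> - (1453/10000)" "v' \<le> 1339/10000"
    for u u' v v' p q :: real
    using that by argo
  ultimately show ?thesis using 1 2 3 4 5 by metis
qed

theorem theorem2:
  fixes \<epsilon> t :: real and a :: "real ^ 'n"
  assumes "0 < \<epsilon>" and "\<epsilon> < 1 / 75"
    and "norm a = 1"
    and "cube_section_volume a t \<ge> (1 - \<epsilon>) * sqrt 2"
  shows "\<exists>j0 j1. j0 \<noteq> j1 \<and>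
           (\<forall>j\<in>{j0, j1}. 1 / sqrt 2 * (1 - 37.5 * \<epsilon>) \<le> \<bar>a $ j\<bar> \<and>
                          \<bar>a $ j\<bar> \<le> 1 / sqrt 2 * (1 + 2 * \<epsilon>)) \<and>
           (\<Sum>j\<in>UNIV - {j0, j1}. (a $ j)\<^sup>2) \<le> 50 * \<epsilon> \<and>
           (\<forall>j. j \<noteq> j0 \<and> j \<noteq> j1 \<longrightarrow> \<bar>a $ j\<bar> \<le> sqrt (50 * \<epsilon>))"
proof -
  note \<epsilon> = assms(1,2) and a = assms(3) and \<sigma> = assms(4)

  \<comment> \<open>The largest square and its upper bounds\<close>
  define x where "x = (\<lambda>j. (a $ j)\<^sup>2)"
  have x0: "0 \<le> x j" for j by (simp add: x_def)
  have sum1: "(\<Sum>j\<in>UNIV. x j) = 1"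
    using a by (simp add: norm_eq_1 inner_vec_def power2_eq_square x_def)
  have "Max (range x) \<in> range x" by (intro Max_in) auto
  then obtain j0 where "Max (range x) = x j0" by blast
  moreover have "x j \<le> Max (range x)" for j by (intro Max_ge) auto
  ultimately have j0: "x j \<le> x j0" for j by simp
  define X where "X = x j0"
  have X: "X = (a $ j0)\<^sup>2" by (simp add: X_def x_def)
  have Xpos: "0 < X"
  proof (rule ccontr)
    assume "\<not> 0 < X"
    then have "x j = 0" for j using j0[of j] x0[of j] by (simp add: X_def)
    then show False using sum1 by simp
  qed
  have aj0: "a $ j0 \<noteq> 0" using Xpos X by auto
  have Xle: "2 * X * (1 - \<epsilon>)\<^sup>2 \<le> 1"
  proof -
    have "(1 - \<epsilon>) * sqrt 2 \<le> 1 / \<bar>a $ j0\<bar>"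
      using \<sigma> cube_section_volume_le_inverse_component[OF a aj0, of t] by linarith
    then have "(1 - \<epsilon>) * sqrt 2 * \<bar>a $ j0\<bar> \<le> 1" using aj0 by (simp add: pos_le_divide_eq)
    then have "((1 - \<epsilon>) * sqrt 2 * \<bar>a $ j0\<bar>)\<^sup>2 \<le> 1"
      using \<epsilon> by (intro power_le_one) auto
    then show ?thesis by (simp add: power_mult_distrib X mult_ac)
  qed
  have sq: "(74/75)\<^sup>2 \<le> (1 - \<epsilon>)\<^sup>2" using \<epsilon> by (intro power_mono) auto
  have X514: "X \<le> 514/1000"
  proof -
    have "2 * X * (74/75)\<^sup>2 \<le> 2 * X * (1 - \<epsilon>)\<^sup>2" using sq Xpos by (intro mult_left_mono) auto
    then have "2 * X * (74/75)\<^sup>2 \<le> 1" using Xle by linarith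
    then show ?thesis by (simp add: power_divide)
  qed
  then have X1: "X < 1" by simp
  have Xu: "X \<le> 1/2 + 103/100 * \<epsilon>"
  proof -
    have "1 \<le> (1 - \<epsilon>)\<^sup>2 * (1 + 206/100 * \<epsilon>)"
    proof -
      \<comment> \<open>A slope slightly above the derivative 2 of
        \<open>1 / (1 - \<epsilon>)^2\<close> at 0 absorbs the higher-order terms for
        \<open>\<epsilon> < 1/75\<close>.\<close>
      have "(1 - \<epsilon>)\<^sup>2 * (1 + 206/100 * \<epsilon>) - 1 = \<epsilon> * (6/100 - 312/100 * \<epsilon> + 206/100 * \<epsilon>\<^sup>2)"
        by (simp add: power2_eq_square field_simps)
      also have "0 \<le> \<dots>" using \<epsilon> by (intro mult_nonneg_nonneg add_nonneg_nonneg) auto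
      finally show ?thesis by simp
    qed
    then have "2 * X * (1 - \<epsilon>)\<^sup>2 \<le> (1 - \<epsilon>)\<^sup>2 * (1 + 206/100 * \<epsilon>)" using Xle by linarith
    then have "(1 - \<epsilon>)\<^sup>2 * (2 * X) \<le> (1 - \<epsilon>)\<^sup>2 * (1 + 206/100 * \<epsilon>)" by (simp add: mult_ac)
    then have "2 * X \<le> 1 + 206/100 * \<epsilon>" using \<epsilon> by (subst (asm) mult_le_cancel_left_pos) auto
    then show ?thesis by simp
  qed
  have D: "\<epsilon> / (1 - \<epsilon>) \<le> 75/74 * \<epsilon>"
  proof -
    have "75 * \<epsilon> * \<epsilon> \<le> 1 * \<epsilon>" using \<epsilon> by (intro mult_right_mono) auto
    then show ?thesis using \<epsilon> by (simp add: pos_divide_le_eq algebra_simps)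
  qed
  have sum_rest: "(\<Sum>j\<in>UNIV - {j0}. x j) = 1 - X"
    using sum1 by (simp add: sum_diff1 X_def)
  \<comment> \<open>Dimension 1 is excluded, since there the largest square would be 1.\<close>
  have ne: "UNIV - {j0} \<noteq> {}"
  proof
    assume "UNIV - {j0} = {}"
    then show False using sum_rest X1 by (simp only: sum.empty)
  qed
  have "Max (x ` (UNIV - {j0})) \<in> x ` (UNIV - {j0})" using ne by (intro Max_in) auto
  then obtain j1 where j01: "j1 \<noteq> j0" and j1_Max: "Max (x ` (UNIV - {j0})) = x j1" by blast
  have j1: "x j \<le> x j1" if "j \<noteq> j0" for j
    unfolding j1_Max[symmetric] using that by (intro Max_ge) auto
  define r where "r = (\<Sum>j\<in>UNIV - {j0, j1}. x j)"
  have sets: "UNIV - {j0} - {j1} = UNIV - {j0, j1}" by auto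
  have split: "(\<Sum>j\<in>UNIV - {j0}. h j) = h j1 + (\<Sum>j\<in>UNIV - {j0, j1}. h j)" for h :: "'n \<Rightarrow> real"
    unfolding sets[symmetric] by (rule sum.remove) (use j01 in auto)
  have r: "X + x j1 + r = 1" using sum_rest unfolding split by (simp add: r_def)
  have r0: "0 \<le> r" unfolding r_def by (intro sum_nonneg x0)
  have \<epsilon>1: "\<epsilon> < 1" using \<epsilon> by simp
  have deficit: "W * mk + (\<Sum>j\<in>UNIV - {j0}. c * x j * m j)
      \<le> \<epsilon> / (1 - \<epsilon>) + (W * ln (W / X) + (1 - W) * ln ((1 - W) / (1 - X))) / 2"
    if "0 < W" "W < 1" "c = (1 - W) / (1 - X)" "moment_gap (1 / W) mk"
      "\<And>j. j \<noteq> j0 \<Longrightarrow> a $ j \<noteq> 0 \<Longrightarrow> moment_gap (1 / (c * x j)) (m j)" for W c mk m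
    using cube_section_deficit[OF a \<epsilon>(1) \<epsilon>1 \<sigma> aj0 X X1 that(1-4), of m] that(5)
    unfolding x_def by blast
  have light: "moment_gap (1 / y) (225/10000)" if "0 < y" "y \<le> 1/3" for y
    using that by (intro moment_gap_ge_3) (simp add: pos_le_divide_eq)
  have xpos: "0 < x j" if "a $ j \<noteq> 0" for j using that by (simp add: x_def)

  \<comment> \<open>The second largest square cannot be small\<close>
  have heavy: "29/100 \<le> x j1"
  proof (rule ccontr)
    assume "\<not> 29/100 \<le> x j1"
    then have small: "x j < 29/100" if "j \<noteq> j0" for j using j1[OF that] by linarith
    show False
    proof (cases "X \<le> 4/9")
      case True
      \<comment> \<open>Natural weights cost no entropy. The gaps average at least
        \<open>4/9 * (115/10000) + 5/9 * (225/10000)\<close>, about 0.0176, above the deficit of at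
        most \<open>1/74\<close>.\<close>
      have "\<exists>mk \<ge> 115/10000. moment_gap (1 / X) mk"
      proof (cases "X \<le> 1/3")
        case True
        then show ?thesis using light Xpos by (intro exI[of _ "225/10000"]) auto
      next
        case False
        then show ?thesis using \<open>X \<le> 4/9\<close> Xpos
          by (intro exI[of _ "115/10000"] conjI moment_gap_9_4_to_3) (simp_all add: pos_le_divide_eq pos_divide_le_eq)
      qed
      then obtain mk where mk: "115/10000 \<le> mk" "moment_gap (1 / X) mk" by blast
      have "moment_gap (1 / (1 * x j)) (225/10000)" if "j \<noteq> j0" "a $ j \<noteq> 0" for j
        using light[of "x j"] small[OF that(1)] xpos[OF that(2)] by simp
      then have "X * mk + (\<Sum>j\<in>UNIV - {j0}. 1 * x j * (225/10000))
          \<le> \<epsilon> / (1 - \<epsilon>) + (X * ln (X / X) + (1 - X) * ln ((1 - X) / (1 - X))) / 2"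
        using X1 Xpos by (intro deficit[OF Xpos X1 _ mk(2)]) auto
      moreover have "(\<Sum>j\<in>UNIV - {j0}. 1 * x j * (225/10000)) = (1 - X) * (225/10000)"
        by (simp only: mult_1 sum_distrib_right[symmetric] sum_rest)
      moreover have "ln (X / X) = 0" "ln ((1 - X) / (1 - X)) = 0" using Xpos X1 by auto
      moreover have "X * (115/10000) \<le> X * mk" using mk Xpos by (intro mult_left_mono) auto
      ultimately show False using D \<epsilon> True by simp
    next
      case False
      \<comment> \<open>The threshold \<open>29/100\<close> is fixed here: after rescaling by
        \<open>c \<le> 1144/1000\<close> the other weights must stay below \<open>1/3\<close>, where
        the gap \<open>225/10000\<close> holds.\<close>
      define c where "c = (1 - 4/9) / (1 - X)"
      have c: "0 < c" "c \<le> 1144/1000" "c * (1 - X) = 5/9"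
        using X514 by (simp_all add: c_def field_simps)
      have "moment_gap (1 / (c * x j)) (225/10000)" if "j \<noteq> j0" "a $ j \<noteq> 0" for j
      proof (rule light)
        show "0 < c * x j" using c xpos[OF that(2)] by simp
        have "c * x j \<le> 1144/1000 * (29/100)"
          using c small[OF that(1)] x0[of j] by (intro mult_mono) auto
        then show "c * x j \<le> 1/3" by simp
      qed
      then have "4/9 * (15/1000) + (\<Sum>j\<in>UNIV - {j0}. c * x j * (225/10000))
          \<le> \<epsilon> / (1 - \<epsilon>) + (4/9 * ln (4/9 / X) + (1 - 4/9) * ln ((1 - 4/9) / (1 - X))) / 2"
        using moment_gap_9_4 by (intro deficit[OF _ _ c_def]) auto
      moreover have "(\<Sum>j\<in>UNIV - {j0}. c * x j * (225/10000)) = 5/9 * (225/10000)"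
        by (simp only: sum_distrib_right[symmetric] sum_distrib_left[symmetric] sum_rest c(3))
      moreover have "4/9 * ln (4/9 / X) + (1 - 4/9) * ln ((1 - 4/9) / (1 - X)) \<le> 99/10000"
        using False X514 by (intro relative_entropy_4_9) auto
      moreover have False
        if "4/9 * (15/1000) + S \<le> d + E / 2" "S = 5/9 * (225/10000)" "E \<le> 99/10000"
          "d \<le> 75/74 * \<epsilon>" for S d E :: real
        using that \<epsilon> by argo
      ultimately show False using D by blast
    qed
  qed
  have x13: "x j \<le> (1 - X) / 2" if "j \<noteq> j0" "j \<noteq> j1" for j
  proof -
    have "x j \<le> r" unfolding r_def using that by (intro member_le_sum x0) auto
    then show ?thesis using j1[OF that(1)] r by (simp add: field_simps)
  qed

  \<comment> \<open>The mass outside the two largest squares\<close>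
  have r24: "r \<le> 24 * \<epsilon>"
  proof (cases "X \<le> 1/2")
    case True
    have "29/100 \<le> X" using heavy j0[of j1] by (simp add: X_def)
    then obtain mk where mk: "moment_gap (1 / X) mk" "22/1000 * (1/2 - X) \<le> X * mk"
      using moment_gap_heavy True by blast
    have "x j1 \<le> 1/2" using j0[of j1] True by (simp add: X_def)
    then obtain m1 where m1: "moment_gap (1 / x j1) m1" "22/1000 * (1/2 - x j1) \<le> x j1 * m1"
      using moment_gap_heavy heavy by blast
    define m where "m = (\<lambda>j. if j = j1 then m1 else 225/10000)"
    have "moment_gap (1 / (1 * x j)) (m j)" if "j \<noteq> j0" "a $ j \<noteq> 0" for j
    proof (cases "j = j1")
      case False
      \<comment> \<open>A third square is at most each of the two largest ones, and the three add up
        to at most 1.\<close>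
      have "x j \<le> 1/3" using x13[OF that(1) False] j1[OF that(1)] j0[of j1] r r0 X_def heavy \<open>29/100 \<le> X\<close>
          \<open>x j1 \<le> 1/2\<close> member_le_sum[of j "UNIV - {j0, j1}" x] x0 that False by (simp add: r_def[symmetric])
      then show ?thesis using False light xpos[OF that(2)] by (simp add: m_def)
    qed (use m1 in \<open>simp add: m_def\<close>)
    then have "X * mk + (\<Sum>j\<in>UNIV - {j0}. 1 * x j * m j)
        \<le> \<epsilon> / (1 - \<epsilon>) + (X * ln (X / X) + (1 - X) * ln ((1 - X) / (1 - X))) / 2"
      using X1 Xpos by (intro deficit[OF Xpos X1 _ mk(1)]) auto
    moreover have "(\<Sum>j\<in>UNIV - {j0}. 1 * x j * m j) = x j1 * m1 + r * (225/10000)"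
    proof -
      have "(\<Sum>j\<in>UNIV - {j0, j1}. 1 * x j * m j) = (\<Sum>j\<in>UNIV - {j0, j1}. x j * (225/10000))"
        by (intro sum.cong) (auto simp: m_def)
      also have "\<dots> = r * (225/10000)" by (simp only: r_def sum_distrib_right)
      finally show ?thesis unfolding split by (simp add: m_def)
    qed
    moreover have "ln (X / X) = 0" "ln ((1 - X) / (1 - X)) = 0" using Xpos X1 by auto
    ultimately have "X * mk + (x j1 * m1 + r * (225/10000)) \<le> \<epsilon> / (1 - \<epsilon>)" by simp
    \<comment> \<open>The distances of \<open>X\<close> and \<open>x j1\<close> from
      \<open>1/2\<close> add up to \<open>r\<close>, so the gaps total at least
      \<open>(22 + 22.5) / 1000 * r\<close>.\<close>
    then show ?thesis using mk(2) m1(2) D r \<epsilon> by argo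
  next
    case False
    define c where "c = (1 - 1/2) / (1 - X)"
    have c: "1 \<le> c" "c * (1 - X) = 1/2" using False X1 by (simp_all add: c_def field_simps)
    have cx: "29/100 \<le> c * x j1"
      using mult_mono[of 1 c "29/100" "x j1"] c heavy by simp
    have cr: "c * x j1 + c * r = 1/2"
    proof -
      have "x j1 + r = 1 - X" using r by simp
      then show ?thesis using c(2) by (simp only: distrib_left[symmetric])
    qed
    have cr0: "r \<le> c * r" using mult_right_mono[OF c(1) r0] by simp
    then obtain m1 where m1: "moment_gap (1 / (c * x j1)) m1" "22/1000 * (1/2 - c * x j1) \<le> c * x j1 * m1"
      using moment_gap_heavy[OF cx] cr r0 by auto
    define m where "m = (\<lambda>j. if j = j1 then m1 else 225/10000)"
    have "moment_gap (1 / (c * x j)) (m j)" if "j \<noteq> j0" "a $ j \<noteq> 0" for j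
    proof (cases "j = j1")
      case False
      have "c * x j \<le> c * ((1 - X) / 2)" using x13[OF that(1) False] c(1) by (intro mult_left_mono) auto
      also have "\<dots> = 1/4" using c(2) by simp
      finally have "c * x j \<le> 1/3" by simp
      moreover have "0 < c * x j" using c(1) xpos[OF that(2)] by (intro mult_pos_pos) auto
      ultimately show ?thesis using False light by (simp add: m_def)
    qed (use m1 in \<open>simp add: m_def\<close>)
    then have "1/2 * 0 + (\<Sum>j\<in>UNIV - {j0}. c * x j * m j)
        \<le> \<epsilon> / (1 - \<epsilon>) + (1/2 * ln (1/2 / X) + (1 - 1/2) * ln ((1 - 1/2) / (1 - X))) / 2"
      using moment_gap_2 by (intro deficit[OF _ _ c_def]) auto
    moreover have "(\<Sum>j\<in>UNIV - {j0}. c * x j * m j) = c * x j1 * m1 + c * r * (225/10000)"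
    proof -
      have "(\<Sum>j\<in>UNIV - {j0, j1}. c * x j * m j) = (\<Sum>j\<in>UNIV - {j0, j1}. c * x j * (225/10000))"
        by (intro sum.cong) (auto simp: m_def)
      also have "\<dots> = c * r * (225/10000)" by (simp only: r_def sum_distrib_right sum_distrib_left)
      finally show ?thesis unfolding split by (simp add: m_def)
    qed
    moreover have "(1/2 * ln (1/2 / X) + (1 - 1/2) * ln ((1 - 1/2) / (1 - X))) / 2 \<le> 15/1000 * \<epsilon>"
    proof -
      \<comment> \<open>The two logarithms combine to \<open>- ln (1 - 4 * u^2)\<close>. Of the two
        factors \<open>u\<close>, one is bounded by a constant and the other by a multiple of
        \<open>\<epsilon>\<close>, which turns the quadratic loss into a small linear one.\<close>
      define u where "u = X - 1/2"
      have u: "0 \<le> u" "u \<le> 14/1000" "u \<le> 103/100 * \<epsilon>" using False X514 Xu by (auto simp: u_def)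
      have uu: "u * u \<le> 14/1000 * (103/100 * \<epsilon>)" using u by (intro mult_mono) auto
      have uu2: "u * u \<le> 14/1000 * (14/1000)" using u by (intro mult_mono) auto
      define q where "q = 1 - 4 * (u * u)"
      have q: "999/1000 \<le> q" using uu2 by (simp add: q_def)
      have "(1/2 / X) * ((1 - 1/2) / (1 - X)) = 1 / q"
        by (simp add: q_def u_def algebra_simps)
      then have "ln (1/2 / X) + ln ((1 - 1/2) / (1 - X)) = ln (1 / q)"
        using ln_mult_pos[of "1/2 / X" "(1 - 1/2) / (1 - X)"] Xpos X1 by simp
      also have "\<dots> \<le> 1 / q - 1" using q by (intro ln_le_minus_one) simp
      also have "\<dots> = 4 * (u * u) / q" using q by (simp add: q_def field_simps)
      also have "\<dots> \<le> 4 * (u * u) / (999/1000)"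
        using q by (intro divide_left_mono) auto
      finally have "ln (1/2 / X) + ln ((1 - 1/2) / (1 - X)) \<le> 4 * (u * u) / (999/1000)" .
      then show ?thesis using uu \<epsilon> by simp
    qed
    ultimately have "c * x j1 * m1 + c * r * (225/10000) \<le> 75/74 * \<epsilon> + 15/1000 * \<epsilon>"
      using D by argo
    \<comment> \<open>The rescaled weights off \<open>j0\<close> sum to \<open>1/2\<close>, so the
      distance of \<open>c * x j1\<close> from \<open>1/2\<close> is \<open>c * r\<close>; only the
      heavy weight and the light ones contribute.\<close>
    then have "445/10000 * (c * r) \<le> 75/74 * \<epsilon> + 15/1000 * \<epsilon>" using m1(2) cr by argo
    then show ?thesis using cr0 \<epsilon> by linarith
  qed

  \<comment> \<open>From the squares back to the components\<close>
  have lower: "1/2 - 2503/100 * \<epsilon> \<le> x j1" using r r24 Xu by linarith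
  have bounds: "1 / sqrt 2 * (1 - 37.5 * \<epsilon>) \<le> \<bar>a $ j\<bar> \<and> \<bar>a $ j\<bar> \<le> 1 / sqrt 2 * (1 + 2 * \<epsilon>)"
    if j: "x j1 \<le> x j" for j
  proof (rule conjI)
    have sq2: "(1 / sqrt 2 * y)\<^sup>2 = 1/2 * y\<^sup>2" for y :: real
      unfolding power_mult_distrib by (simp add: power_divide)
    have "(1 / sqrt 2 * (1 - 37.5 * \<epsilon>))\<^sup>2 = 1/2 * (1 - 37.5 * \<epsilon>)\<^sup>2"
      by (rule sq2)
    also have "\<dots> = 1/2 - 75/2 * \<epsilon> + 5625/8 * (\<epsilon> * \<epsilon>)"
      by (simp add: power2_eq_square algebra_simps)
    \<comment> \<open>The quadratic term costs at most \<open>75/8 * \<epsilon>\<close>; the slope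
      left over is \<open>225/8\<close>, above the required \<open>2503/100\<close>.\<close>
    also have "\<dots> \<le> 1/2 - 2503/100 * \<epsilon>"
    proof -
      have "\<epsilon> * \<epsilon> \<le> 1/75 * \<epsilon>" using \<epsilon> by (intro mult_right_mono) auto
      then have "5625/8 * (\<epsilon> * \<epsilon>) \<le> 75/8 * \<epsilon>" by simp
      then show ?thesis using \<epsilon> by linarith
    qed
    also have "\<dots> \<le> x j" using lower j by (rule order_trans)
    also have "x j = \<bar>a $ j\<bar>\<^sup>2" by (simp only: x_def power2_abs)
    finally show "1 / sqrt 2 * (1 - 37.5 * \<epsilon>) \<le> \<bar>a $ j\<bar>" by (rule power2_le_imp_le) simp
    have "\<bar>a $ j\<bar>\<^sup>2 = x j" by (simp only: x_def power2_abs)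
    also have "x j \<le> 1/2 + 103/100 * \<epsilon>" using j0[of j] Xu unfolding X_def by (rule order_trans)
    also have "\<dots> \<le> 1/2 + 2 * \<epsilon> + 2 * (\<epsilon> * \<epsilon>)"
      using \<epsilon> zero_le_square[of \<epsilon>] by linarith
    also have "\<dots> = 1/2 * (1 + 2 * \<epsilon>)\<^sup>2"
      by (simp add: power2_eq_square algebra_simps)
    also have "\<dots> = (1 / sqrt 2 * (1 + 2 * \<epsilon>))\<^sup>2"
      by (rule sq2[symmetric])
    finally show "\<bar>a $ j\<bar> \<le> 1 / sqrt 2 * (1 + 2 * \<epsilon>)"
      by (rule power2_le_imp_le) (use \<epsilon> in simp)
  qed
  have r50: "r \<le> 50 * \<epsilon>" using r24 \<epsilon> by simp
  have rest: "\<bar>a $ j\<bar> \<le> sqrt (50 * \<epsilon>)" if "j \<noteq> j0" "j \<noteq> j1" for j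
  proof (rule real_le_rsqrt)
    have "x j \<le> r" unfolding r_def using that by (intro member_le_sum x0) auto
    then show "\<bar>a $ j\<bar>\<^sup>2 \<le> 50 * \<epsilon>" using r50 by (simp add: x_def)
  qed
  show ?thesis
  proof (rule exI[of _ j0], rule exI[of _ j1], intro conjI)
    show "j0 \<noteq> j1" using j01 by blast
    show "\<forall>j\<in>{j0, j1}. 1 / sqrt 2 * (1 - 37.5 * \<epsilon>) \<le> \<bar>a $ j\<bar> \<and> \<bar>a $ j\<bar> \<le> 1 / sqrt 2 * (1 + 2 * \<epsilon>)"
      using bounds[OF j0] bounds[OF order_refl] by blast
    show "(\<Sum>j\<in>UNIV - {j0, j1}. (a $ j)\<^sup>2) \<le> 50 * \<epsilon>"
      using r50 by (simp add: r_def x_def)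
    show "\<forall>j. j \<noteq> j0 \<and> j \<noteq> j1 \<longrightarrow> \<bar>a $ j\<bar> \<le> sqrt (50 * \<epsilon>)"
      using rest by blast
  qed
qed

end
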